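(* (i) $\mathcal{A}(r,n)^{\mathbf T}=\mathcal{A}(r,n)^{\mathbf T_{r+2}}$. (ii) A fixed point $\alpha_\mu\in\mathcal{A}(r,n)^{\mathbf T}$ belongs to $\mathcal{Q}(r,n)^{\mathbf T}$ (viewed inside $\mathcal{A}(r,n)$ via $\imath$) if and only if the $r$-partition $\mu$ is nested, i.e. $\mu_r\subseteq\mu_{r-1}\subseteq\cdots\subseteq\mu_1$ as Young diagrams. Hence $\mathcal{Q}(r,n)^{\mathbf T}$ is finite and in bijection with nested $r$-partitions of $n$. (iii) The closed embedding $\mathcal{Q}_0(r,n)\hookrightarrow\mathcal{Q}(r,n)$ induces an isomorphism of $\mathbf T$-fixed loci. Hence $\mathcal{Q}_0(r,n)^{\mathbf T}$ is also finite and in bijection with nested $r$-partitions of $n$.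
   Context: **Moduli spaces.** $\mathcal{A}(r,n)$ is the moduli space of stable ADHM data $(V,B_1,B_2,I,J)$ with $\dim V=n$, $V_\infty=\mathbb{C}^r$ (basis $e_a$), $[B_1,B_2]+IJ=0$, and no proper $B_1,B_2$-invariant subspace containing $\mathrm{Im}\,I$. It is identified with the moduli space of rank $r$ framed torsion-free sheaves on $\mathbb{P}^2$ with $c_2=n$. $\mathcal{Q}(r,n)$ is the moduli space of framed cyclic representations $(V,B_1,B_2,B_3,I,J)$. These satisfy $[B_1,B_2]+IJ=0$, $JB_3=A_rJ$, $B_3I=IA_r$ and $[B_3,B_1]=[B_3,B_2]=0$, where $A_re_a=e_{a+1}$ and $e_{r+1}=0$, and no proper nonzero $B_1,B_2,B_3$-invariant subspace contains $\mathrm{Im}\,I$. The closed embedding $\imath:\mathcal{Q}(r,n)\to\mathcal{A}(r,n)$ forgets $B_3$. $\mathcal{Q}_0(r,n)\subset\mathcal{Q}(r,n)$ is the closed subscheme where $J=0$. **Torus actions.** $\mathbf{T}_{r+2}=(\mathbb{C}^\times)^2\times(\mathbb{C}^\times)^r$ acts on $\mathcal{A}(r,n)$ by $(t_1,t_2,u)\cdot(B_1,B_2,I,J)=(t_1B_1,t_2B_2,Iu^{-1},t_1t_2uJ)$, where $u=\mathrm{diag}(u_1,\dots,u_r)$. Its fixed points $\alpha_\mu$ are finitely many and indexed by $r$-partitions $\mu=(\mu_1,\dots,\mu_r)$ of $n$. The point $\alpha_\mu$ corresponds to the framed sheaf $\bigoplus_aI_{Z_{\mu_a}}$, where $I_{Z_{\mu_a}}$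 is the monomial ideal of $\mu_a$ in $\mathbb{A}^2=\mathbb{P}^2\setminus\{z_0=0\}$. $\mathbf{T}=(\mathbb{C}^\times)^3$ embeds in $\mathbf{T}_{r+2}$ by $(t_1,t_2,t_3)\mapsto(t_1,t_2,(t_3^{1-a})_{1\leq a\leq r})$. Writing $I_a=I(e_a)$ and $J_a$ for the components of $J$, $\mathbf{T}$ acts on $\mathcal{Q}(r,n)$ by $(t_i)\cdot(B_i,I_a,J_a)=(t_iB_i,\,t_3^{a-1}I_a,\,t_1t_2t_3^{1-a}J_a)$ for $1\leq i\leq3$. On $\mathcal{A}(r,n)$ it acts by the same formula with $B_3$ omitted. *)

theory Defs
  imports Complex_Main "HOL-Library.Product_Lexorder" "Jordan_Normal_Form.Matrix"
begin

(* All moduli spaces are modelled by their sets of closed points: a point is a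
   GL(V)-orbit (equivalence class) of stable data, with V = C^n (column vectors
   of dimension n) and V_infty = C^r.  Indices are 0-based: e_a (paper, a=1..r)
   is the standard basis vector number a-1. *)

type_synonym adhm = "complex mat \<times> complex mat \<times> complex mat \<times> complex mat"
type_synonym cycrep = "complex mat \<times> complex mat \<times> complex mat \<times> complex mat \<times> complex mat"

definition vsubspace :: "nat \<Rightarrow> complex vec set \<Rightarrow> bool" where
  "vsubspace n S \<longleftrightarrow> S \<subseteq> carrier_vec n \<and> 0\<^sub>v n \<in> S \<and>
     (\<forall>v\<in>S. \<forall>w\<in>S. v + w \<in> S) \<and> (\<forall>c. \<forall>v\<in>S. c \<cdot>\<^sub>v v \<in> S)"

definition stable_wrt :: "nat \<Rightarrow> nat \<Rightarrow> complex mat list \<Rightarrow> complex mat \<Rightarrow> bool" where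
  "stable_wrt r n Bs I \<longleftrightarrow>
     (\<forall>S. vsubspace n S \<and> (\<forall>B\<in>set Bs. \<forall>v\<in>S. B *\<^sub>v v \<in> S)
          \<and> (\<forall>w\<in>carrier_vec r. I *\<^sub>v w \<in> S) \<longrightarrow> S = carrier_vec n)"

definition shift_mat :: "nat \<Rightarrow> complex mat" where
  "shift_mat r = mat r r (\<lambda>(i,j). if i = Suc j then 1 else 0)"

definition adhm_data :: "nat \<Rightarrow> nat \<Rightarrow> adhm \<Rightarrow> bool" where
  "adhm_data r n x \<longleftrightarrow> (case x of (B1,B2,I,J) \<Rightarrow>
     B1 \<in> carrier_mat n n \<and> B2 \<in> carrier_mat n n \<and> I \<in> carrier_mat n r \<and> J \<in> carrier_mat r n \<and>
     B1 * B2 - B2 * B1 + I * J = 0\<^sub>m n n \<and> stable_wrt r n [B1, B2] I)"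

definition cyc_data :: "nat \<Rightarrow> nat \<Rightarrow> cycrep \<Rightarrow> bool" where
  "cyc_data r n x \<longleftrightarrow> (case x of (B1,B2,B3,I,J) \<Rightarrow>
     B1 \<in> carrier_mat n n \<and> B2 \<in> carrier_mat n n \<and> B3 \<in> carrier_mat n n \<and>
     I \<in> carrier_mat n r \<and> J \<in> carrier_mat r n \<and>
     B1 * B2 - B2 * B1 + I * J = 0\<^sub>m n n \<and>
     J * B3 = shift_mat r * J \<and> B3 * I = I * shift_mat r \<and>
     B3 * B1 = B1 * B3 \<and> B3 * B2 = B2 * B3 \<and>
     stable_wrt r n [B1, B2, B3] I)"

definition adhm_equiv :: "nat \<Rightarrow> adhm \<Rightarrow> adhm \<Rightarrow> bool" where
  "adhm_equiv n x y \<longleftrightarrow> (case x of (B1,B2,I,J) \<Rightarrow> case y of (B1',B2',I',J') \<Rightarrow>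
     (\<exists>g \<in> carrier_mat n n. invertible_mat g \<and>
        B1' * g = g * B1 \<and> B2' * g = g * B2 \<and> I' = g * I \<and> J' * g = J))"

definition cyc_equiv :: "nat \<Rightarrow> cycrep \<Rightarrow> cycrep \<Rightarrow> bool" where
  "cyc_equiv n x y \<longleftrightarrow> (case x of (B1,B2,B3,I,J) \<Rightarrow> case y of (B1',B2',B3',I',J') \<Rightarrow>
     (\<exists>g \<in> carrier_mat n n. invertible_mat g \<and>
        B1' * g = g * B1 \<and> B2' * g = g * B2 \<and> B3' * g = g * B3 \<and> I' = g * I \<and> J' * g = J))"

definition adhm_class :: "nat \<Rightarrow> nat \<Rightarrow> adhm \<Rightarrow> adhm set" where
  "adhm_class r n x = {y. adhm_data r n y \<and> adhm_equiv n x y}"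

definition cyc_class :: "nat \<Rightarrow> nat \<Rightarrow> cycrep \<Rightarrow> cycrep set" where
  "cyc_class r n x = {y. cyc_data r n y \<and> cyc_equiv n x y}"

definition A_moduli :: "nat \<Rightarrow> nat \<Rightarrow> adhm set set" where
  "A_moduli r n = adhm_class r n ` {x. adhm_data r n x}"

definition Q_moduli :: "nat \<Rightarrow> nat \<Rightarrow> cycrep set set" where
  "Q_moduli r n = cyc_class r n ` {x. cyc_data r n x}"

definition Q0_moduli :: "nat \<Rightarrow> nat \<Rightarrow> cycrep set set" where
  "Q0_moduli r n = {X \<in> Q_moduli r n. \<forall>x\<in>X. (case x of (B1,B2,B3,I,J) \<Rightarrow> J = 0\<^sub>m r n)}"

definition forget_B3 :: "cycrep \<Rightarrow> adhm" where
  "forget_B3 x = (case x of (B1,B2,B3,I,J) \<Rightarrow> (B1,B2,I,J))"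

definition iota :: "nat \<Rightarrow> nat \<Rightarrow> cycrep set \<Rightarrow> adhm set" where
  "iota r n X = adhm_class r n (forget_B3 (SOME x. x \<in> X))"

definition big_torus :: "nat \<Rightarrow> (complex \<times> complex \<times> (nat \<Rightarrow> complex)) set" where
  "big_torus r = {(t1,t2,u). t1 \<noteq> 0 \<and> t2 \<noteq> 0 \<and> (\<forall>a<r. u a \<noteq> 0)}"

definition adhm_act :: "nat \<Rightarrow> nat \<Rightarrow> complex \<times> complex \<times> (nat \<Rightarrow> complex) \<Rightarrow> adhm \<Rightarrow> adhm" where
  "adhm_act r n t x = (case t of (t1,t2,u) \<Rightarrow> case x of (B1,B2,I,J) \<Rightarrow>
     (t1 \<cdot>\<^sub>m B1, t2 \<cdot>\<^sub>m B2,
      mat n r (\<lambda>(k,a). I $$ (k,a) * inverse (u a)),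
      mat r n (\<lambda>(a,k). t1 * t2 * u a * J $$ (a,k))))"

(* embedding T = (C^* )^3 -> T_{r+2}: u_a = t3^(1-a) (1-based a), i.e. t3^(-a) 0-based *)
definition small_to_big :: "complex \<Rightarrow> complex \<Rightarrow> complex \<Rightarrow> complex \<times> complex \<times> (nat \<Rightarrow> complex)" where
  "small_to_big t1 t2 t3 = (t1, t2, \<lambda>a. inverse (t3 ^ a))"

definition cyc_act :: "nat \<Rightarrow> nat \<Rightarrow> complex \<Rightarrow> complex \<Rightarrow> complex \<Rightarrow> cycrep \<Rightarrow> cycrep" where
  "cyc_act r n t1 t2 t3 x = (case x of (B1,B2,B3,I,J) \<Rightarrow>
     (t1 \<cdot>\<^sub>m B1, t2 \<cdot>\<^sub>m B2, t3 \<cdot>\<^sub>m B3,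
      mat n r (\<lambda>(k,a). t3 ^ a * I $$ (k,a)),
      mat r n (\<lambda>(a,k). t1 * t2 * inverse (t3 ^ a) * J $$ (a,k))))"

definition A_fixed_big :: "nat \<Rightarrow> nat \<Rightarrow> adhm set set" where
  "A_fixed_big r n = {X \<in> A_moduli r n. \<forall>t \<in> big_torus r. adhm_act r n t ` X = X}"

definition A_fixed_T :: "nat \<Rightarrow> nat \<Rightarrow> adhm set set" where
  "A_fixed_T r n = {X \<in> A_moduli r n. \<forall>t1 t2 t3. t1 \<noteq> 0 \<and> t2 \<noteq> 0 \<and> t3 \<noteq> 0 \<longrightarrow>
      adhm_act r n (small_to_big t1 t2 t3) ` X = X}"

definition Q_fixed_T :: "nat \<Rightarrow> nat \<Rightarrow> cycrep set set" where
  "Q_fixed_T r n = {X \<in> Q_moduli r n. \<forall>t1 t2 t3. t1 \<noteq> 0 \<and> t2 \<noteq> 0 \<and> t3 \<noteq> 0 \<longrightarrow>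
      cyc_act r n t1 t2 t3 ` X = X}"

definition Q0_fixed_T :: "nat \<Rightarrow> nat \<Rightarrow> cycrep set set" where
  "Q0_fixed_T r n = {X \<in> Q0_moduli r n. \<forall>t1 t2 t3. t1 \<noteq> 0 \<and> t2 \<noteq> 0 \<and> t3 \<noteq> 0 \<longrightarrow>
      cyc_act r n t1 t2 t3 ` X = X}"

(* Young diagrams: finite down-closed sets of cells (i,j) <-> monomials x^i y^j
   not in the monomial ideal *)
definition young :: "(nat \<times> nat) set \<Rightarrow> bool" where
  "young Y \<longleftrightarrow> finite Y \<and> (\<forall>i j i' j'. (i,j) \<in> Y \<and> i' \<le> i \<and> j' \<le> j \<longrightarrow> (i',j') \<in> Y)"

(* r-partitions of n: mu_0, ..., mu_{r-1} (paper: mu_1..mu_r) *)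
definition r_partitions :: "nat \<Rightarrow> nat \<Rightarrow> (nat \<Rightarrow> (nat \<times> nat) set) set" where
  "r_partitions r n = {\<mu>. (\<forall>a<r. young (\<mu> a)) \<and> (\<forall>a\<ge>r. \<mu> a = {}) \<and> (\<Sum>a<r. card (\<mu> a)) = n}"

definition nested :: "nat \<Rightarrow> (nat \<Rightarrow> (nat \<times> nat) set) \<Rightarrow> bool" where
  "nested r \<mu> \<longleftrightarrow> (\<forall>a. Suc a < r \<longrightarrow> \<mu> (Suc a) \<subseteq> \<mu> a)"

definition nested_partitions :: "nat \<Rightarrow> nat \<Rightarrow> (nat \<Rightarrow> (nat \<times> nat) set) set" where
  "nested_partitions r n = {\<mu> \<in> r_partitions r n. nested r \<mu>}"

(* the fixed point alpha_mu: V = (+)_a C[x,y]/I_{mu_a}, basis = cells (a,i,j) ~ x^i y^j in summand a,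
   ordered lexicographically; B1 = mult. by x, B2 = mult. by y, I(e_a) = 1 in summand a, J = 0 *)
definition cells :: "nat \<Rightarrow> (nat \<Rightarrow> (nat \<times> nat) set) \<Rightarrow> (nat \<times> nat \<times> nat) set" where
  "cells r \<mu> = {(a,i,j). a < r \<and> (i,j) \<in> \<mu> a}"

definition alpha_data :: "nat \<Rightarrow> nat \<Rightarrow> (nat \<Rightarrow> (nat \<times> nat) set) \<Rightarrow> adhm" where
  "alpha_data r n \<mu> = (let L = sorted_list_of_set (cells r \<mu>) in
     (mat n n (\<lambda>(k,l). case L ! l of (a,i,j) \<Rightarrow> if L ! k = (a, Suc i, j) then 1 else 0),
      mat n n (\<lambda>(k,l). case L ! l of (a,i,j) \<Rightarrow> if L ! k = (a, i, Suc j) then 1 else 0),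
      mat n r (\<lambda>(k,a). if L ! k = (a, 0, 0) then 1 else 0),
      0\<^sub>m r n))"

definition alpha :: "nat \<Rightarrow> nat \<Rightarrow> (nat \<Rightarrow> (nat \<times> nat) set) \<Rightarrow> adhm set" where
  "alpha r n \<mu> = adhm_class r n (alpha_data r n \<mu>)"

end

theory Submission
  imports Defs "Jordan_Normal_Form.Char_Poly" "HOL-Computational_Algebra.Primes"
begin

(* Everything is tested on the single torus element (2, 3, 5). If a datum is fixed by it up to a
   gauge transformation g, the monomials B1^i B2^j I e_a are eigenvectors of g with the pairwise
   distinct eigenvalues 2^i 3^j 5^a, whereas the rows of J could only be nonzero on the eigenvalues
   5^b / 6. Hence J = 0, B1 and B2 commute, the nonzero monomials form an r-partition mu, and by
   stability they form a basis of V identifying the datum with alpha_mu. Conversely alpha_mu is fixed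
   by all of T_(r+2): rescale x^i y^j in summand a by t1^i t2^j / u_a. This proves (i). For a cyclic
   representation B3 maps the monomials of summand a to those of summand a + 1, forcing
   mu_(a+1) <= mu_a, and for nested mu such a B3 exists on alpha_mu; as mu is recovered from alpha_mu
   as the set of nonvanishing monomials, this gives (ii), and J = 0 on all fixed points gives (iii). *)

section \<open>Matrices, subspaces and invertibility\<close>

lemma mult_unit_vec_eq_col:
  fixes A :: "'a :: semiring_1 mat"
  assumes "A \<in> carrier_mat n m" "l < m"
  shows "A *\<^sub>v unit_vec m l = col A l"
  using assms by (intro eq_vecI) (auto simp: scalar_prod_right_unit)

lemma mat_eqI_unit_vec:
  fixes A B :: "'a :: semiring_1 mat"
  assumes "A \<in> carrier_mat n m" "B \<in> carrier_mat n m"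
    and "\<And>l. l < m \<Longrightarrow> A *\<^sub>v unit_vec m l = B *\<^sub>v unit_vec m l"
  shows "A = B"
  using assms by (intro mat_col_eqI) (auto simp: mult_unit_vec_eq_col[symmetric])

lemma mult_mat_zero_vec [simp]:
  fixes A :: "'a :: semiring_0 mat"
  assumes "A \<in> carrier_mat n m"
  shows "A *\<^sub>v 0\<^sub>v m = 0\<^sub>v n"
  using assms by (intro eq_vecI) auto

lemma col_carrier_vec [simp]: "A \<in> carrier_mat n m \<Longrightarrow> col A j \<in> carrier_vec n"
  by (simp add: carrier_vecI)

lemma smult_mat_mult_vec:
  fixes A :: "'a :: comm_semiring_0 mat"
  assumes "A \<in> carrier_mat n m" "v \<in> carrier_vec m"
  shows "(c \<cdot>\<^sub>m A) *\<^sub>v v = c \<cdot>\<^sub>v (A *\<^sub>v v)"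
  using assms by (intro eq_vecI) (auto simp: scalar_prod_def sum_distrib_left mult.assoc)

lemma vsubspace_zero: "vsubspace n S \<Longrightarrow> 0\<^sub>v n \<in> S"
  and vsubspace_add: "vsubspace n S \<Longrightarrow> v \<in> S \<Longrightarrow> w \<in> S \<Longrightarrow> v + w \<in> S"
  and vsubspace_smult: "vsubspace n S \<Longrightarrow> v \<in> S \<Longrightarrow> c \<cdot>\<^sub>v v \<in> S"
  and vsubspace_carrier: "vsubspace n S \<Longrightarrow> S \<subseteq> carrier_vec n"
  unfolding vsubspace_def by auto

lemma vsubspace_preimage:
  assumes "vsubspace n S" "A \<in> carrier_mat n m"
  shows "vsubspace m {v \<in> carrier_vec m. A *\<^sub>v v \<in> S}"
  using assms vsubspace_zero[OF assms(1)] vsubspace_add[OF assms(1)] vsubspace_smult[OF assms(1)]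
  unfolding vsubspace_def
  by (auto simp: mult_add_distrib_mat_vec[OF assms(2)] mult_mat_vec[OF assms(2)])

lemma vsubspace_image:
  assumes "A \<in> carrier_mat n m"
  shows "vsubspace n ((\<lambda>w. A *\<^sub>v w) ` carrier_vec m)"
  unfolding vsubspace_def
proof (intro conjI ballI allI)
  fix v w assume "v \<in> (\<lambda>w. A *\<^sub>v w) ` carrier_vec m" "w \<in> (\<lambda>w. A *\<^sub>v w) ` carrier_vec m"
  then show "v + w \<in> (\<lambda>w. A *\<^sub>v w) ` carrier_vec m"
    using assms by (auto simp: mult_add_distrib_mat_vec[OF assms, symmetric])
next
  fix c v assume "v \<in> (\<lambda>w. A *\<^sub>v w) ` carrier_vec m"
  then show "c \<cdot>\<^sub>v v \<in> (\<lambda>w. A *\<^sub>v w) ` carrier_vec m"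
    using assms by (auto simp: mult_mat_vec[OF assms, symmetric])
next
  show "0\<^sub>v n \<in> (\<lambda>w. A *\<^sub>v w) ` carrier_vec m"
    using assms by (auto intro!: image_eqI[of _ _ "0\<^sub>v m"])
qed (use assms in auto)

lemma mult_mat_vec_in_vsubspace:
  assumes S: "vsubspace n S" and A: "A \<in> carrier_mat n m"
    and cols: "\<And>l. l < m \<Longrightarrow> col A l \<in> S" and w: "w \<in> carrier_vec m"
  shows "A *\<^sub>v w \<in> S"
proof -
  define trunc where "trunc k = vec m (\<lambda>i. if i < k then w $ i else 0)" for k
  have "A *\<^sub>v trunc k \<in> S" if "k \<le> m" for k
    using that
  proof (induction k)
    case 0
    have "trunc 0 = 0\<^sub>v m" by (auto simp: trunc_def)
    then show ?case using A vsubspace_zero[OF S] by simp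
  next
    case (Suc k)
    have "trunc (Suc k) = trunc k + w $ k \<cdot>\<^sub>v unit_vec m k"
      by (intro eq_vecI) (auto simp: trunc_def less_Suc_eq unit_vec_def)
    then have "A *\<^sub>v trunc (Suc k) = A *\<^sub>v trunc k + w $ k \<cdot>\<^sub>v col A k"
      using A Suc.prems
      by (simp add: mult_add_distrib_mat_vec[OF A] trunc_def mult_mat_vec[OF A] mult_unit_vec_eq_col)
    then show ?case
      using Suc vsubspace_add[OF S] vsubspace_smult[OF S] cols by simp
  qed
  moreover have "trunc m = w" using w by (intro eq_vecI) (auto simp: trunc_def)
  ultimately show ?thesis by auto
qed

lemma vsubspace_eq_carrier_vecI:
  assumes S: "vsubspace n S" and units: "\<And>k. k < n \<Longrightarrow> unit_vec n k \<in> S"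
  shows "S = carrier_vec n"
proof
  show "carrier_vec n \<subseteq> S"
  proof
    fix w :: "complex vec" assume w: "w \<in> carrier_vec n"
    have "1\<^sub>m n *\<^sub>v w \<in> S"
      by (rule mult_mat_vec_in_vsubspace[OF S _ _ w]) (use units in auto)
    then show "w \<in> S" using w by simp
  qed
qed (use vsubspace_carrier[OF S] in blast)

lemma invertible_mat_iff_inverse:
  fixes g :: "'a :: semiring_1 mat"
  assumes g: "g \<in> carrier_mat n n"
  shows "invertible_mat g \<longleftrightarrow> (\<exists>h\<in>carrier_mat n n. g * h = 1\<^sub>m n \<and> h * g = 1\<^sub>m n)"
proof
  assume "invertible_mat g"
  then obtain h where h1: "g * h = 1\<^sub>m n" and h2: "h * g = 1\<^sub>m (dim_row h)"
    using g unfolding invertible_mat_def inverts_mat_def by auto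
  have "h \<in> carrier_mat n n"
    using h1 h2 g by (metis carrier_matD carrier_matI index_mult_mat(2,3) index_one_mat(2,3))
  then show "\<exists>h\<in>carrier_mat n n. g * h = 1\<^sub>m n \<and> h * g = 1\<^sub>m n" using h1 h2 by auto
next
  assume "\<exists>h\<in>carrier_mat n n. g * h = 1\<^sub>m n \<and> h * g = 1\<^sub>m n"
  then show "invertible_mat g"
    using g unfolding invertible_mat_def inverts_mat_def by (metis carrier_matD square_mat.simps)
qed

lemma invertible_mat_one: "invertible_mat (1\<^sub>m n :: 'a :: semiring_1 mat)"
  by (subst invertible_mat_iff_inverse[of _ n]) (auto intro: bexI[of _ "1\<^sub>m n"])

lemma invertible_mat_mult:
  fixes g g' :: "'a :: semiring_1 mat"
  assumes g: "g \<in> carrier_mat n n" "invertible_mat g" and g': "g' \<in> carrier_mat n n" "invertible_mat g'"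
  shows "invertible_mat (g' * g)"
proof -
  obtain h where h: "h \<in> carrier_mat n n" "g * h = 1\<^sub>m n" "h * g = 1\<^sub>m n"
    using g invertible_mat_iff_inverse by blast
  obtain h' where h': "h' \<in> carrier_mat n n" "g' * h' = 1\<^sub>m n" "h' * g' = 1\<^sub>m n"
    using g' invertible_mat_iff_inverse by blast
  have "g' * g * (h * h') = g' * ((g * h) * h')"
    using g(1) h(1) g'(1) h'(1) by (simp add: assoc_mult_mat[of _ n n _ n _ n])
  also have "\<dots> = 1\<^sub>m n" using h h' by simp
  finally have left: "g' * g * (h * h') = 1\<^sub>m n" .
  have "h * h' * (g' * g) = h * ((h' * g') * g)"
    using g(1) h(1) g'(1) h'(1) by (simp add: assoc_mult_mat[of _ n n _ n _ n])
  also have "\<dots> = 1\<^sub>m n" using g h h' by simp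
  finally have right: "h * h' * (g' * g) = 1\<^sub>m n" .
  show ?thesis
    using invertible_mat_iff_inverse[OF mult_carrier_mat[OF g'(1) g(1)]]
      left right mult_carrier_mat[OF h(1) h'(1)] by metis
qed

lemma invertible_mat_mult_vec_eq_zero_iff:
  fixes g :: "'a :: semiring_1 mat"
  assumes g: "g \<in> carrier_mat n n" "invertible_mat g" and v: "v \<in> carrier_vec n"
  shows "g *\<^sub>v v = 0\<^sub>v n \<longleftrightarrow> v = 0\<^sub>v n"
proof
  assume gv: "g *\<^sub>v v = 0\<^sub>v n"
  obtain h where h: "h \<in> carrier_mat n n" "h * g = 1\<^sub>m n" using g invertible_mat_iff_inverse by blast
  have "v = (h * g) *\<^sub>v v" using h(2) v by simp
  also have "\<dots> = h *\<^sub>v (g *\<^sub>v v)" by (rule assoc_mult_mat_vec[OF h(1) g(1) v])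
  finally show "v = 0\<^sub>v n" using gv h(1) by simp
qed (use g in simp)

lemma right_inverse_if_surjective:
  fixes P :: "'a :: field mat"
  assumes P: "P \<in> carrier_mat n m"
    and surj: "\<And>v. v \<in> carrier_vec n \<Longrightarrow> \<exists>w\<in>carrier_vec m. P *\<^sub>v w = v"
  shows "\<exists>Q\<in>carrier_mat m n. P * Q = 1\<^sub>m n"
proof -
  define pre where "pre j = (SOME w. w \<in> carrier_vec m \<and> P *\<^sub>v w = unit_vec n j)" for j
  have pre: "pre j \<in> carrier_vec m \<and> P *\<^sub>v pre j = unit_vec n j" for j
    unfolding pre_def by (rule someI_ex) (use surj[of "unit_vec n j"] in auto)
  define Q where "Q = mat m n (\<lambda>(k,j). pre j $ k)"
  have Q: "Q \<in> carrier_mat m n" by (simp add: Q_def)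
  have "P * Q = 1\<^sub>m n"
  proof (rule mat_eqI_unit_vec)
    fix j assume j: "j < n"
    have "Q *\<^sub>v unit_vec n j = pre j"
      using j Q pre[of j] by (auto simp: mult_unit_vec_eq_col[OF Q] Q_def intro!: eq_vecI)
    then show "(P * Q) *\<^sub>v unit_vec n j = 1\<^sub>m n *\<^sub>v unit_vec n j"
      using P Q pre[of j] by (simp add: assoc_mult_mat_vec[OF P Q])
  qed (use P Q in auto)
  then show ?thesis using Q by blast
qed

lemma invertible_if_surjective:
  fixes P :: "'a :: field mat"
  assumes P: "P \<in> carrier_mat n n"
    and surj: "\<And>v. v \<in> carrier_vec n \<Longrightarrow> \<exists>w\<in>carrier_vec n. P *\<^sub>v w = v"
  shows "invertible_mat P"
  using right_inverse_if_surjective[OF P surj] mat_mult_left_right_inverse[OF P]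
    invertible_mat_iff_inverse[OF P] by blast

text \<open>Padding a surjective \<open>n \<times> m\<close> matrix with \<open>n - m\<close> zero columns gives a surjective, hence
  invertible, square matrix that kills the last unit vector; so there is no room for \<open>m < n\<close>.\<close>

lemma surjective_mat_dim_eq:
  fixes P :: "'a :: field mat"
  assumes P: "P \<in> carrier_mat n m" and le: "m \<le> n"
    and surj: "\<And>v. v \<in> carrier_vec n \<Longrightarrow> \<exists>w\<in>carrier_vec m. P *\<^sub>v w = v"
  shows "m = n"
proof (rule ccontr)
  assume "m \<noteq> n"
  with le have lt: "m < n" by simp
  define P' where "P' = mat n n (\<lambda>(i,k). if k < m then P $$ (i,k) else 0)"
  have P': "P' \<in> carrier_mat n n" by (simp add: P'_def)
  have "\<exists>w'\<in>carrier_vec n. P' *\<^sub>v w' = v" if v: "v \<in> carrier_vec n" for v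
  proof -
    obtain w where w: "w \<in> carrier_vec m" "P *\<^sub>v w = v" using surj[OF v] by auto
    define w' where "w' = vec n (\<lambda>k. if k < m then w $ k else 0)"
    have "P' *\<^sub>v w' = P *\<^sub>v w"
    proof (rule eq_vecI)
      fix i assume "i < dim_vec (P *\<^sub>v w)"
      then have i: "i < n" using P by simp
      have "(P' *\<^sub>v w') $ i = (\<Sum>k\<in>{0..<n}. if k < m then P $$ (i,k) * w $ k else 0)"
        using i unfolding P'_def w'_def by (auto simp: scalar_prod_def intro!: sum.cong)
      also have "\<dots> = (\<Sum>k\<in>{0..<m}. P $$ (i,k) * w $ k)"
        using lt by (simp add: sum.If_cases) (intro sum.cong, auto)
      also have "\<dots> = (P *\<^sub>v w) $ i" using i P w(1) by (simp add: scalar_prod_def)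
      finally show "(P' *\<^sub>v w') $ i = (P *\<^sub>v w) $ i" .
    qed (use P P' in auto)
    then show ?thesis using w by (auto simp: w'_def)
  qed
  then obtain Q where Q: "Q \<in> carrier_mat n n" "P' * Q = 1\<^sub>m n"
    using right_inverse_if_surjective[OF P'] by blast
  have QP': "Q * P' = 1\<^sub>m n" using mat_mult_left_right_inverse[OF P' Q] .
  let ?u = "unit_vec n (n - 1) :: 'a vec"
  have "P' *\<^sub>v ?u = 0\<^sub>v n"
    using lt P' by (auto simp: mult_unit_vec_eq_col[OF P'] P'_def intro!: eq_vecI)
  then have "?u = 0\<^sub>v n"
    using assoc_mult_mat_vec[OF Q(1) P', of ?u] QP' Q(1) by simp
  then show False using lt unit_vec_nonzero[of "n - 1" n] by simp
qed

lemma shift_mat_carrier [simp]: "shift_mat r \<in> carrier_mat r r"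
  by (simp add: shift_mat_def)

lemma shift_mat_unit_vec:
  assumes "a < r"
  shows "shift_mat r *\<^sub>v unit_vec r a = (if Suc a < r then unit_vec r (Suc a) else 0\<^sub>v r)"
proof -
  have "shift_mat r *\<^sub>v unit_vec r a = col (shift_mat r) a"
    using assms by (simp add: mult_unit_vec_eq_col[of _ r r])
  also have "\<dots> = vec r (\<lambda>i. if i = Suc a then 1 else 0)"
    using assms by (intro eq_vecI) (auto simp: shift_mat_def)
  finally show ?thesis by (auto simp: unit_vec_def intro!: eq_vecI)
qed

lemma pow_mat_intertwine:
  fixes C X A :: "'a :: semiring_1 mat"
  assumes C: "C \<in> carrier_mat n n" and X: "X \<in> carrier_mat n m" and A: "A \<in> carrier_mat m m"
    and CX: "C * X = X * A"
  shows "C ^\<^sub>m k * X = X * A ^\<^sub>m k"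
proof (induction k)
  case (Suc k)
  have "C ^\<^sub>m Suc k * X = C ^\<^sub>m k * (C * X)"
    using C X by (simp add: assoc_mult_mat[of _ n n _ n _ m])
  also have "\<dots> = (C ^\<^sub>m k * X) * A"
    using C X A CX by (simp add: assoc_mult_mat[of _ n n _ m _ m])
  also have "\<dots> = X * A ^\<^sub>m Suc k"
    using C X A Suc by (simp add: assoc_mult_mat[of _ n m _ m _ m])
  finally show ?case .
qed (use C X A in simp)

lemma pow_mat_Suc_left:
  fixes A :: "'a :: semiring_1 mat"
  assumes "A \<in> carrier_mat n n"
  shows "A * A ^\<^sub>m k = A ^\<^sub>m Suc k"
  using pow_mat_intertwine[OF assms assms assms refl] by simp

lemma pow_mat_mult_vec_intertwine:
  fixes C X A :: "'a :: semiring_1 mat"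
  assumes C: "C \<in> carrier_mat n n" and X: "X \<in> carrier_mat n m" and A: "A \<in> carrier_mat m m"
    and CX: "C * X = X * A" and v: "v \<in> carrier_vec m"
  shows "C ^\<^sub>m k *\<^sub>v (X *\<^sub>v v) = X *\<^sub>v (A ^\<^sub>m k *\<^sub>v v)"
proof -
  have "C ^\<^sub>m k *\<^sub>v (X *\<^sub>v v) = (C ^\<^sub>m k * X) *\<^sub>v v"
    using assoc_mult_mat_vec[OF pow_carrier_mat[OF C] X v] by simp
  also have "\<dots> = X *\<^sub>v (A ^\<^sub>m k *\<^sub>v v)"
    using pow_mat_intertwine[OF C X A CX] assoc_mult_mat_vec[OF X pow_carrier_mat[OF A] v] by simp
  finally show ?thesis .
qed

section \<open>Stability\<close>

lemma stable_wrtI: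
  assumes "\<And>S. vsubspace n S \<Longrightarrow> (\<And>B v. B \<in> set Bs \<Longrightarrow> v \<in> S \<Longrightarrow> B *\<^sub>v v \<in> S)
    \<Longrightarrow> (\<And>w. w \<in> carrier_vec r \<Longrightarrow> I *\<^sub>v w \<in> S) \<Longrightarrow> S = carrier_vec n"
  shows "stable_wrt r n Bs I"
  using assms unfolding stable_wrt_def by auto

lemma stable_wrtD:
  assumes "stable_wrt r n Bs I" "vsubspace n S" "\<And>B v. B \<in> set Bs \<Longrightarrow> v \<in> S \<Longrightarrow> B *\<^sub>v v \<in> S"
    "\<And>w. w \<in> carrier_vec r \<Longrightarrow> I *\<^sub>v w \<in> S"
  shows "S = carrier_vec n"
  using assms unfolding stable_wrt_def by auto

lemma stable_wrt_mono:
  "stable_wrt r n Bs I \<Longrightarrow> set Bs \<subseteq> set Bs' \<Longrightarrow> stable_wrt r n Bs' I"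
  unfolding stable_wrt_def by (metis subsetD)

lemma stable_wrt_conj:
  assumes st: "stable_wrt r n Bs I"
    and g: "g \<in> carrier_mat n n" "invertible_mat g" and I: "I \<in> carrier_mat n r"
    and Bs: "list_all2 (\<lambda>B B'. B \<in> carrier_mat n n \<and> B' \<in> carrier_mat n n \<and> B' * g = g * B) Bs Bs'"
  shows "stable_wrt r n Bs' (g * I)"
proof (rule stable_wrtI)
  fix S assume S: "vsubspace n S" and S_inv: "\<And>B' v. B' \<in> set Bs' \<Longrightarrow> v \<in> S \<Longrightarrow> B' *\<^sub>v v \<in> S"
    and S_I: "\<And>w. w \<in> carrier_vec r \<Longrightarrow> (g * I) *\<^sub>v w \<in> S"
  define T where "T = {v \<in> carrier_vec n. g *\<^sub>v v \<in> S}"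
  have "T = carrier_vec n"
  proof (rule stable_wrtD[OF st])
    show "vsubspace n T" unfolding T_def by (rule vsubspace_preimage[OF S g(1)])
    show "B *\<^sub>v v \<in> T" if "B \<in> set Bs" "v \<in> T" for B v
    proof -
      obtain i where "i < length Bs" "B = Bs ! i" using \<open>B \<in> set Bs\<close> by (auto simp: in_set_conv_nth)
      then obtain B' where B': "B' \<in> set Bs'" "B \<in> carrier_mat n n" "B' \<in> carrier_mat n n" "B' * g = g * B"
        using Bs nth_mem by (fastforce simp: list_all2_conv_all_nth)
      have v: "v \<in> carrier_vec n" "g *\<^sub>v v \<in> S" using \<open>v \<in> T\<close> by (simp_all add: T_def)
      have "g *\<^sub>v (B *\<^sub>v v) = (g * B) *\<^sub>v v" using g B' v by simp
      also have "\<dots> = B' *\<^sub>v (g *\<^sub>v v)" using g B' v by (simp flip: B'(4))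
      finally show ?thesis using S_inv[OF B'(1) v(2)] B'(2) v(1) by (simp add: T_def)
    qed
    show "I *\<^sub>v w \<in> T" if "w \<in> carrier_vec r" for w
      using S_I[OF that] g I that by (simp add: T_def)
  qed
  obtain h where h: "h \<in> carrier_mat n n" "g * h = 1\<^sub>m n"
    using g invertible_mat_iff_inverse by blast
  have "v \<in> S" if v: "v \<in> carrier_vec n" for v
  proof -
    have "h *\<^sub>v v \<in> T" using \<open>T = carrier_vec n\<close> h v by simp
    then have "g *\<^sub>v (h *\<^sub>v v) \<in> S" by (simp add: T_def)
    moreover have "g *\<^sub>v (h *\<^sub>v v) = v"
      using assoc_mult_mat_vec[OF g(1) h(1) v] h(2) v by simp
    ultimately show ?thesis by simp
  qed
  then show "S = carrier_vec n" using vsubspace_carrier[OF S] by blast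
qed

lemma stable_wrt_drop_commuting:
  assumes st: "stable_wrt r n (C # Bs) I"
    and C: "C \<in> carrier_mat n n" and Bs: "\<And>B. B \<in> set Bs \<Longrightarrow> B \<in> carrier_mat n n \<and> C * B = B * C"
    and I: "I \<in> carrier_mat n r" and A: "A \<in> carrier_mat r r" and CI: "C * I = I * A"
  shows "stable_wrt r n Bs I"
proof (rule stable_wrtI)
  fix S assume S: "vsubspace n S" and S_inv: "\<And>B v. B \<in> set Bs \<Longrightarrow> v \<in> S \<Longrightarrow> B *\<^sub>v v \<in> S"
    and S_I: "\<And>w. w \<in> carrier_vec r \<Longrightarrow> I *\<^sub>v w \<in> S"
  define T where "T = {v \<in> carrier_vec n. \<forall>k. C ^\<^sub>m k *\<^sub>v v \<in> S}"
  have "T = carrier_vec n"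
  proof (rule stable_wrtD[OF st])
    show "vsubspace n T"
      using S C unfolding vsubspace_def T_def
      by (auto simp: mult_add_distrib_mat_vec[OF pow_carrier_mat[OF C]] mult_mat_vec[OF pow_carrier_mat[OF C]]
          mult_mat_zero_vec[OF pow_carrier_mat[OF C]])
    show "X *\<^sub>v v \<in> T" if X: "X \<in> set (C # Bs)" and v: "v \<in> T" for X v
    proof -
      have v_C: "v \<in> carrier_vec n" using v by (simp add: T_def)
      consider "X = C" | "X \<in> set Bs" using X by auto
      then have "C ^\<^sub>m k *\<^sub>v (X *\<^sub>v v) \<in> S" for k
      proof cases
        case 1
        have "C ^\<^sub>m k *\<^sub>v (C *\<^sub>v v) = C ^\<^sub>m Suc k *\<^sub>v v"
          using assoc_mult_mat_vec[OF pow_carrier_mat[OF C] C v_C] by simp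
        moreover have "C ^\<^sub>m Suc k *\<^sub>v v \<in> S" using v unfolding T_def by blast
        ultimately show ?thesis using 1 by simp
      next
        case 2
        then have B: "X \<in> carrier_mat n n" "C * X = X * C" using Bs by auto
        then show ?thesis
          using pow_mat_mult_vec_intertwine[OF C B(1) C B(2) v_C] S_inv[OF 2] v unfolding T_def by simp
      qed
      moreover have "X \<in> carrier_mat n n" using X C Bs by auto
      ultimately show ?thesis using v_C by (simp add: T_def)
    qed
    show "I *\<^sub>v w \<in> T" if w: "w \<in> carrier_vec r" for w
      using pow_mat_mult_vec_intertwine[OF C I A CI w] S_I[OF mult_mat_vec_carrier[OF pow_carrier_mat[OF A] w]] I w
      by (simp add: T_def)
  qed
  then have "C ^\<^sub>m 0 *\<^sub>v v \<in> S" if "v \<in> carrier_vec n" for v using that unfolding T_def by blast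
  then show "S = carrier_vec n" using C vsubspace_carrier[OF S] by auto
qed

section \<open>Framed data up to the action of \<open>GL(V)\<close>\<close>

lemma conj_mat_sym:
  fixes g h B B' :: "'a :: semiring_1 mat"
  assumes c: "g \<in> carrier_mat n n" "h \<in> carrier_mat n n" "B \<in> carrier_mat n n" "B' \<in> carrier_mat n n"
    and gh: "g * h = 1\<^sub>m n" "h * g = 1\<^sub>m n" and conj: "B' * g = g * B"
  shows "B * h = h * B'"
proof -
  have "h * B' = h * (B' * g) * h" using c gh by (simp add: assoc_mult_mat[of _ n n _ n _ n])
  also have "\<dots> = (h * g) * B * h" using c conj by (simp add: assoc_mult_mat[of _ n n _ n _ n])
  also have "\<dots> = B * h" using c gh by simp
  finally show ?thesis by simp
qed

lemma conj_mat_trans: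
  fixes g g' B B' B'' :: "'a :: semiring_1 mat"
  assumes g: "g \<in> carrier_mat n n" "g' \<in> carrier_mat n n"
    and c: "B \<in> carrier_mat n n" "B' \<in> carrier_mat n n" "B'' \<in> carrier_mat n n"
    and conj: "B' * g = g * B" "B'' * g' = g' * B'"
  shows "B'' * (g' * g) = (g' * g) * B"
proof -
  have "B'' * (g' * g) = (B'' * g') * g" using assoc_mult_mat[OF c(3) g(2) g(1)] by simp
  also have "\<dots> = g' * (B' * g)" using assoc_mult_mat[OF g(2) c(2) g(1)] conj(2) by simp
  also have "\<dots> = (g' * g) * B" using assoc_mult_mat[OF g(2) g(1) c(1)] conj(1) by simp
  finally show ?thesis .
qed

lemma conj_mat_eq:
  fixes g h B B' :: "'a :: semiring_1 mat"
  assumes c: "g \<in> carrier_mat n n" "h \<in> carrier_mat n n" "B \<in> carrier_mat n n" "B' \<in> carrier_mat n n"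
    and gh: "g * h = 1\<^sub>m n" and conj: "B' * g = g * B"
  shows "B' = g * B * h"
proof -
  have "B' = B' * (g * h)" using c gh by simp
  also have "\<dots> = (B' * g) * h" using assoc_mult_mat[OF c(4,1,2)] by simp
  finally show ?thesis using conj by simp
qed

lemma conj_mat_mult:
  fixes g h X Y :: "'a :: semiring_1 mat"
  assumes c: "g \<in> carrier_mat n n" "h \<in> carrier_mat n n" "X \<in> carrier_mat n n" "Y \<in> carrier_mat n n"
    and hg: "h * g = 1\<^sub>m n"
  shows "(g * X * h) * (g * Y * h) = g * (X * Y) * h"
proof -
  have "(g * X * h) * (g * Y * h) = g * X * (h * g) * Y * h"
    using c by (simp add: assoc_mult_mat[of _ n n _ n _ n])
  also have "\<dots> = g * (X * Y) * h" using c hg by (simp add: assoc_mult_mat[of _ n n _ n _ n])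
  finally show ?thesis .
qed

text \<open>ADHM data and cyclic representations are both framed quiver data: a list of
  endomorphisms of \<open>V = \<complex>\<^sup>n\<close> together with \<open>I : \<complex>\<^sup>r \<rightarrow> V\<close> and \<open>J : V \<rightarrow> \<complex>\<^sup>r\<close>, on which
  \<open>GL(V)\<close> acts by conjugation.\<close>

type_synonym framed = "complex mat list \<times> complex mat \<times> complex mat"

definition framed_carrier :: "nat \<Rightarrow> nat \<Rightarrow> framed \<Rightarrow> bool" where
  "framed_carrier r n x \<longleftrightarrow> (case x of (Bs, I, J) \<Rightarrow>
     set Bs \<subseteq> carrier_mat n n \<and> I \<in> carrier_mat n r \<and> J \<in> carrier_mat r n)"

definition framed_equiv :: "nat \<Rightarrow> framed \<Rightarrow> framed \<Rightarrow> bool" where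
  "framed_equiv n x y \<longleftrightarrow> (case x of (Bs, I, J) \<Rightarrow> case y of (Bs', I', J') \<Rightarrow>
     (\<exists>g\<in>carrier_mat n n. invertible_mat g \<and>
        list_all2 (\<lambda>B B'. B' * g = g * B) Bs Bs' \<and> I' = g * I \<and> J' * g = J))"

definition adhm_framed :: "adhm \<Rightarrow> framed" where
  "adhm_framed x = (case x of (B1, B2, I, J) \<Rightarrow> ([B1, B2], I, J))"

definition cyc_framed :: "cycrep \<Rightarrow> framed" where
  "cyc_framed x = (case x of (B1, B2, B3, I, J) \<Rightarrow> ([B1, B2, B3], I, J))"

lemma adhm_equiv_iff_framed: "adhm_equiv n x y \<longleftrightarrow> framed_equiv n (adhm_framed x) (adhm_framed y)"
  by (auto simp: adhm_equiv_def framed_equiv_def adhm_framed_def split: prod.splits)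

lemma cyc_equiv_iff_framed: "cyc_equiv n x y \<longleftrightarrow> framed_equiv n (cyc_framed x) (cyc_framed y)"
  by (auto simp: cyc_equiv_def framed_equiv_def cyc_framed_def split: prod.splits)

lemma adhm_data_carrier: "adhm_data r n x \<Longrightarrow> framed_carrier r n (adhm_framed x)"
  by (auto simp: adhm_data_def framed_carrier_def adhm_framed_def split: prod.splits)

lemma cyc_data_carrier: "cyc_data r n x \<Longrightarrow> framed_carrier r n (cyc_framed x)"
  by (auto simp: cyc_data_def framed_carrier_def cyc_framed_def split: prod.splits)

lemma framed_equiv_refl: "framed_carrier r n x \<Longrightarrow> framed_equiv n x x"
  by (auto simp: framed_equiv_def framed_carrier_def list_all2_same invertible_mat_one
      split: prod.splits intro!: bexI[of _ "1\<^sub>m n"])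

lemma framed_equiv_sym:
  assumes x: "framed_carrier r n x" and y: "framed_carrier r n y" and xy: "framed_equiv n x y"
  shows "framed_equiv n y x"
proof -
  obtain Bs I J Bs' I' J' where xy_eq: "x = (Bs, I, J)" "y = (Bs', I', J')" by (cases x, cases y) auto
  obtain g where g: "g \<in> carrier_mat n n" "invertible_mat g" "list_all2 (\<lambda>B B'. B' * g = g * B) Bs Bs'"
    "I' = g * I" "J' * g = J"
    using xy by (auto simp: framed_equiv_def xy_eq)
  obtain h where h: "h \<in> carrier_mat n n" "g * h = 1\<^sub>m n" "h * g = 1\<^sub>m n"
    using g invertible_mat_iff_inverse by blast
  have c: "set Bs \<subseteq> carrier_mat n n" "set Bs' \<subseteq> carrier_mat n n" "I \<in> carrier_mat n r" "J' \<in> carrier_mat r n"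
    using x y by (auto simp: framed_carrier_def xy_eq)
  have "list_all2 (\<lambda>B' B. B * h = h * B') Bs' Bs"
  proof (unfold list_all2_conv_all_nth, intro conjI allI impI)
    show "length Bs' = length Bs" using g(3) by (simp add: list_all2_lengthD)
    fix i assume "i < length Bs'"
    then have i: "i < length Bs" using g(3) by (simp add: list_all2_lengthD)
    have "Bs ! i \<in> carrier_mat n n" "Bs' ! i \<in> carrier_mat n n"
      using c(1,2) i \<open>i < length Bs'\<close> nth_mem by blast+
    moreover have "Bs' ! i * g = g * Bs ! i" using g(3) i by (simp add: list_all2_conv_all_nth)
    ultimately show "Bs ! i * h = h * Bs' ! i" using conj_mat_sym[OF g(1) h(1) _ _ h(2,3)] by blast
  qed
  moreover have "h * I' = I"
    using g(4) assoc_mult_mat[OF h(1) g(1) c(3)] h(3) c(3) by simp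
  moreover have "J * h = J'"
    using g(5)[symmetric] assoc_mult_mat[OF c(4) g(1) h(1)] h(2) c(4) by simp
  moreover have "invertible_mat h" using g(1) h invertible_mat_iff_inverse by blast
  ultimately show ?thesis using h(1) by (force simp: framed_equiv_def xy_eq)
qed

lemma framed_equiv_trans:
  assumes x: "framed_carrier r n x" and y: "framed_carrier r n y" and z: "framed_carrier r n z"
    and xy: "framed_equiv n x y" and yz: "framed_equiv n y z"
  shows "framed_equiv n x z"
proof -
  obtain Bs I J Bs' I' J' Bs'' I'' J'' where xyz: "x = (Bs, I, J)" "y = (Bs', I', J')" "z = (Bs'', I'', J'')"
    by (cases x, cases y, cases z) auto
  obtain g where g: "g \<in> carrier_mat n n" "invertible_mat g" "list_all2 (\<lambda>B B'. B' * g = g * B) Bs Bs'"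
    "I' = g * I" "J' * g = J"
    using xy by (auto simp: framed_equiv_def xyz)
  obtain g' where g': "g' \<in> carrier_mat n n" "invertible_mat g'"
    "list_all2 (\<lambda>B B'. B' * g' = g' * B) Bs' Bs''" "I'' = g' * I'" "J'' * g' = J'"
    using yz by (auto simp: framed_equiv_def xyz)
  have c: "set Bs \<subseteq> carrier_mat n n" "set Bs' \<subseteq> carrier_mat n n" "set Bs'' \<subseteq> carrier_mat n n"
    "I \<in> carrier_mat n r" "J'' \<in> carrier_mat r n"
    using x y z by (auto simp: framed_carrier_def xyz)
  have "list_all2 (\<lambda>B B''. B'' * (g' * g) = (g' * g) * B) Bs Bs''"
  proof (unfold list_all2_conv_all_nth, intro conjI allI impI)
    show "length Bs = length Bs''" using g(3) g'(3) by (simp add: list_all2_lengthD)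
    fix i assume "i < length Bs"
    then have i: "i < length Bs'" "i < length Bs''" using g(3) g'(3) by (simp_all add: list_all2_lengthD)
    have "Bs ! i \<in> carrier_mat n n" "Bs' ! i \<in> carrier_mat n n" "Bs'' ! i \<in> carrier_mat n n"
      using c(1-3) i \<open>i < length Bs\<close> nth_mem by blast+
    moreover have "Bs' ! i * g = g * Bs ! i" "Bs'' ! i * g' = g' * Bs' ! i"
      using g(3) g'(3) i by (simp_all add: list_all2_conv_all_nth)
    ultimately show "Bs'' ! i * (g' * g) = (g' * g) * Bs ! i" by (rule conj_mat_trans[OF g(1) g'(1)])
  qed
  moreover have "I'' = (g' * g) * I" using g(4) g'(4) assoc_mult_mat[OF g'(1) g(1) c(4)] by simp
  moreover have "J'' * (g' * g) = J" using g(5) g'(5) assoc_mult_mat[OF c(5) g'(1) g(1)] by simp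
  ultimately show ?thesis
    using invertible_mat_mult[OF g(1,2) g'(1,2)] g(1) g'(1) by (auto simp: framed_equiv_def xyz)
qed

lemma adhm_relation_iff:
  fixes B1 B2 I J :: "complex mat"
  assumes c: "B1 \<in> carrier_mat n n" "B2 \<in> carrier_mat n n" "I \<in> carrier_mat n r" "J \<in> carrier_mat r n"
  shows "B1 * B2 - B2 * B1 + I * J = 0\<^sub>m n n \<longleftrightarrow> B1 * B2 + I * J = B2 * B1"
proof
  assume h: "B1 * B2 - B2 * B1 + I * J = 0\<^sub>m n n"
  show "B1 * B2 + I * J = B2 * B1"
  proof (rule eq_matI)
    fix i j assume ij: "i < dim_row (B2 * B1)" "j < dim_col (B2 * B1)"
    then have "(B1 * B2 - B2 * B1 + I * J) $$ (i,j) = 0" using h c by simp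
    then show "(B1 * B2 + I * J) $$ (i, j) = (B2 * B1) $$ (i, j)" using ij c by (simp add: algebra_simps)
  qed (use c in auto)
next
  assume h: "B1 * B2 + I * J = B2 * B1"
  show "B1 * B2 - B2 * B1 + I * J = 0\<^sub>m n n"
  proof (rule eq_matI)
    fix i j assume ij: "i < dim_row (0\<^sub>m n n :: complex mat)" "j < dim_col (0\<^sub>m n n :: complex mat)"
    then have "(B1 * B2 + I * J) $$ (i,j) = (B2 * B1) $$ (i,j)" using h by simp
    then show "(B1 * B2 - B2 * B1 + I * J) $$ (i, j) = 0\<^sub>m n n $$ (i, j)" using ij c by (simp add: algebra_simps)
  qed (use c in auto)
qed

lemma conj_adhm_relation:
  fixes g h B1 B2 I J :: "complex mat"
  assumes c: "g \<in> carrier_mat n n" "h \<in> carrier_mat n n" "B1 \<in> carrier_mat n n" "B2 \<in> carrier_mat n n"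
    "I \<in> carrier_mat n r" "J \<in> carrier_mat r n"
    and hg: "h * g = 1\<^sub>m n" and rel: "B1 * B2 + I * J = B2 * B1"
  shows "(g * B1 * h) * (g * B2 * h) + (g * I) * (J * h) = (g * B2 * h) * (g * B1 * h)"
proof -
  have "(g * I) * (J * h) = g * (I * J) * h"
    using assoc_mult_mat[OF c(1) c(5) mult_carrier_mat[OF c(6) c(2)]] assoc_mult_mat[OF c(5) c(6) c(2)]
      assoc_mult_mat[OF c(1) mult_carrier_mat[OF c(5) c(6)] c(2)] by simp
  then have "(g * B1 * h) * (g * B2 * h) + (g * I) * (J * h) = g * (B1 * B2) * h + g * (I * J) * h"
    using conj_mat_mult[OF c(1-4) hg] by simp
  also have "\<dots> = g * (B1 * B2 + I * J) * h" using c
    by (simp add: mult_add_distrib_mat[of _ n n _ n] add_mult_distrib_mat[of _ n n _ _ n])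
  also have "\<dots> = (g * B2 * h) * (g * B1 * h)" using conj_mat_mult[OF c(1,2,4,3) hg] rel by simp
  finally show ?thesis .
qed

lemma adhm_data_transport:
  assumes x: "adhm_data r n x" and y: "framed_carrier r n (adhm_framed y)" and xy: "adhm_equiv n x y"
  shows "adhm_data r n y"
proof -
  obtain B1 B2 I J B1' B2' I' J' where xy_eq: "x = (B1, B2, I, J)" "y = (B1', B2', I', J')"
    by (cases x, cases y) auto
  obtain g where g: "g \<in> carrier_mat n n" "invertible_mat g" "B1' * g = g * B1" "B2' * g = g * B2"
    "I' = g * I" "J' * g = J"
    using xy unfolding adhm_equiv_def xy_eq by auto
  obtain h where h: "h \<in> carrier_mat n n" "g * h = 1\<^sub>m n" "h * g = 1\<^sub>m n"
    using g invertible_mat_iff_inverse by blast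
  have c: "B1 \<in> carrier_mat n n" "B2 \<in> carrier_mat n n" "I \<in> carrier_mat n r" "J \<in> carrier_mat r n"
    "B1' \<in> carrier_mat n n" "B2' \<in> carrier_mat n n" "I' \<in> carrier_mat n r" "J' \<in> carrier_mat r n"
    using x y unfolding xy_eq adhm_data_def framed_carrier_def adhm_framed_def by auto
  have rel: "B1 * B2 + I * J = B2 * B1"
    using x c adhm_relation_iff unfolding xy_eq adhm_data_def by auto
  have B': "B1' = g * B1 * h" "B2' = g * B2 * h"
    using conj_mat_eq[OF g(1) h(1) c(1) c(5) h(2) g(3)] conj_mat_eq[OF g(1) h(1) c(2) c(6) h(2) g(4)] .
  have J': "J' = J * h" using g(6)[symmetric] assoc_mult_mat[OF c(8) g(1) h(1)] h(2) c(8) by simp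
  have "B1' * B2' + I' * J' = B2' * B1'"
    unfolding B' J' g(5) by (rule conj_adhm_relation[OF g(1) h(1) c(1-4) h(3) rel])
  moreover have "stable_wrt r n [B1', B2'] I'"
    using x stable_wrt_conj[OF _ g(1,2) c(3), of "[B1, B2]" "[B1', B2']"] c g(3-5)
    unfolding xy_eq adhm_data_def by simp
  ultimately show ?thesis using c adhm_relation_iff[OF c(5-8)] unfolding adhm_data_def xy_eq by simp
qed

lemma conj_cyc_relations:
  fixes g h B1 B2 B3 I J A :: "complex mat"
  assumes c: "g \<in> carrier_mat n n" "h \<in> carrier_mat n n" "B1 \<in> carrier_mat n n" "B2 \<in> carrier_mat n n"
    "B3 \<in> carrier_mat n n" "I \<in> carrier_mat n r" "J \<in> carrier_mat r n" "A \<in> carrier_mat r r"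
    and hg: "h * g = 1\<^sub>m n"
    and rel: "J * B3 = A * J" "B3 * I = I * A" "B3 * B1 = B1 * B3" "B3 * B2 = B2 * B3"
  shows "(J * h) * (g * B3 * h) = A * (J * h)" "(g * B3 * h) * (g * I) = (g * I) * A"
    "(g * B3 * h) * (g * B1 * h) = (g * B1 * h) * (g * B3 * h)"
    "(g * B3 * h) * (g * B2 * h) = (g * B2 * h) * (g * B3 * h)"
proof -
  have "(J * h) * (g * B3 * h) = J * (h * g) * B3 * h" using c
    by (simp add: assoc_mult_mat[of _ r n _ n _ n] assoc_mult_mat[of _ n n _ n _ n])
  also have "\<dots> = A * (J * h)" using hg c rel(1) assoc_mult_mat[OF c(8) c(7) c(2)]
    by (simp add: assoc_mult_mat[of _ r r _ n _ n])
  finally show "(J * h) * (g * B3 * h) = A * (J * h)" .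
  have "(g * B3 * h) * (g * I) = g * B3 * (h * g) * I" using c
    by (simp add: assoc_mult_mat[of _ n n _ n _ r] assoc_mult_mat[of _ n n _ n _ n])
  also have "\<dots> = (g * I) * A" using hg c rel(2)
    by (simp add: assoc_mult_mat[of _ n n _ n _ r] assoc_mult_mat[of _ n n _ r _ r])
  finally show "(g * B3 * h) * (g * I) = (g * I) * A" .
  show "(g * B3 * h) * (g * B1 * h) = (g * B1 * h) * (g * B3 * h)"
    using conj_mat_mult[OF c(1,2,5,3) hg] conj_mat_mult[OF c(1,2,3,5) hg] rel(3) by simp
  show "(g * B3 * h) * (g * B2 * h) = (g * B2 * h) * (g * B3 * h)"
    using conj_mat_mult[OF c(1,2,5,4) hg] conj_mat_mult[OF c(1,2,4,5) hg] rel(4) by simp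
qed

lemma cyc_data_transport:
  assumes x: "cyc_data r n x" and y: "framed_carrier r n (cyc_framed y)" and xy: "cyc_equiv n x y"
  shows "cyc_data r n y"
proof -
  obtain B1 B2 B3 I J B1' B2' B3' I' J' where xy_eq: "x = (B1, B2, B3, I, J)" "y = (B1', B2', B3', I', J')"
    by (cases x, cases y) auto
  obtain g where g: "g \<in> carrier_mat n n" "invertible_mat g" "B1' * g = g * B1" "B2' * g = g * B2"
    "B3' * g = g * B3" "I' = g * I" "J' * g = J"
    using xy unfolding cyc_equiv_def xy_eq by auto
  obtain h where h: "h \<in> carrier_mat n n" "g * h = 1\<^sub>m n" "h * g = 1\<^sub>m n"
    using g invertible_mat_iff_inverse by blast
  have c: "B1 \<in> carrier_mat n n" "B2 \<in> carrier_mat n n" "B3 \<in> carrier_mat n n" "I \<in> carrier_mat n r"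
    "J \<in> carrier_mat r n" "B1' \<in> carrier_mat n n" "B2' \<in> carrier_mat n n" "B3' \<in> carrier_mat n n"
    "I' \<in> carrier_mat n r" "J' \<in> carrier_mat r n"
    using x y unfolding xy_eq cyc_data_def framed_carrier_def cyc_framed_def by auto
  have rel: "B1 * B2 + I * J = B2 * B1" "J * B3 = shift_mat r * J" "B3 * I = I * shift_mat r"
    "B3 * B1 = B1 * B3" "B3 * B2 = B2 * B3"
    using x c adhm_relation_iff unfolding xy_eq cyc_data_def by auto
  have B': "B1' = g * B1 * h" "B2' = g * B2 * h" "B3' = g * B3 * h"
    using conj_mat_eq[OF g(1) h(1) c(1) c(6) h(2) g(3)] conj_mat_eq[OF g(1) h(1) c(2) c(7) h(2) g(4)]
      conj_mat_eq[OF g(1) h(1) c(3) c(8) h(2) g(5)] .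
  have J': "J' = J * h" using g(7)[symmetric] assoc_mult_mat[OF c(10) g(1) h(1)] h(2) c(10) by simp
  have "B1' * B2' + I' * J' = B2' * B1'"
    unfolding B' J' g(6) by (rule conj_adhm_relation[OF g(1) h(1) c(1,2,4,5) h(3) rel(1)])
  moreover have "J' * B3' = shift_mat r * J'" "B3' * I' = I' * shift_mat r"
    "B3' * B1' = B1' * B3'" "B3' * B2' = B2' * B3'"
    unfolding B' J' g(6) using conj_cyc_relations[OF g(1) h(1) c(1-5) shift_mat_carrier h(3) rel(2-5)] by simp_all
  moreover have "stable_wrt r n [B1', B2', B3'] I'"
    using x stable_wrt_conj[OF _ g(1,2) c(4), of "[B1, B2, B3]" "[B1', B2', B3']"] c g(3-6)
    unfolding xy_eq cyc_data_def by simp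
  ultimately show ?thesis using c adhm_relation_iff[OF c(6,7,9,10)] unfolding cyc_data_def xy_eq by simp
qed

lemma adhm_mem_class: "adhm_data r n x \<Longrightarrow> x \<in> adhm_class r n x"
  using framed_equiv_refl[OF adhm_data_carrier] by (simp add: adhm_class_def adhm_equiv_iff_framed)

lemma cyc_mem_class: "cyc_data r n x \<Longrightarrow> x \<in> cyc_class r n x"
  using framed_equiv_refl[OF cyc_data_carrier] by (simp add: cyc_class_def cyc_equiv_iff_framed)

lemma adhm_class_eq:
  assumes x: "adhm_data r n x" and y: "adhm_data r n y" and xy: "adhm_equiv n x y"
  shows "adhm_class r n x = adhm_class r n y"
proof -
  note c = adhm_data_carrier[OF x] adhm_data_carrier[OF y]
  have "adhm_equiv n x z \<longleftrightarrow> adhm_equiv n y z" if "adhm_data r n z" for z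
    using framed_equiv_trans[OF c(1,2) adhm_data_carrier[OF that]]
      framed_equiv_trans[OF c(2,1) adhm_data_carrier[OF that] framed_equiv_sym[OF c]] xy
    unfolding adhm_equiv_iff_framed by blast
  then show ?thesis unfolding adhm_class_def by blast
qed

lemma cyc_class_eq:
  assumes x: "cyc_data r n x" and y: "cyc_data r n y" and xy: "cyc_equiv n x y"
  shows "cyc_class r n x = cyc_class r n y"
proof -
  note c = cyc_data_carrier[OF x] cyc_data_carrier[OF y]
  have "cyc_equiv n x z \<longleftrightarrow> cyc_equiv n y z" if "cyc_data r n z" for z
    using framed_equiv_trans[OF c(1,2) cyc_data_carrier[OF that]]
      framed_equiv_trans[OF c(2,1) cyc_data_carrier[OF that] framed_equiv_sym[OF c]] xy
    unfolding cyc_equiv_iff_framed by blast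
  then show ?thesis unfolding cyc_class_def by blast
qed

section \<open>Torus actions\<close>

definition diag_matrix :: "nat \<Rightarrow> (nat \<Rightarrow> 'a :: zero) \<Rightarrow> 'a mat" where
  "diag_matrix r f = mat r r (\<lambda>(i, j). if i = j then f i else 0)"

lemma diag_matrix_carrier [simp]: "diag_matrix r f \<in> carrier_mat r r"
  and dim_diag_matrix [simp]: "dim_row (diag_matrix r f) = r" "dim_col (diag_matrix r f) = r"
  by (simp_all add: diag_matrix_def)

lemma col_diag_matrix: "a < r \<Longrightarrow> col (diag_matrix r f) a = f a \<cdot>\<^sub>v unit_vec r (a :: nat)"
  for f :: "nat \<Rightarrow> 'a :: semiring_1"
  by (intro eq_vecI) (auto simp: diag_matrix_def unit_vec_def)

lemma row_diag_matrix: "a < r \<Longrightarrow> row (diag_matrix r f) a = f a \<cdot>\<^sub>v unit_vec r (a :: nat)"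
  for f :: "nat \<Rightarrow> 'a :: semiring_1"
  by (intro eq_vecI) (auto simp: diag_matrix_def unit_vec_def)

lemma mult_diag_matrix:
  fixes I :: "'a :: comm_semiring_1 mat"
  assumes "I \<in> carrier_mat n r"
  shows "I * diag_matrix r f = mat n r (\<lambda>(k, a). I $$ (k, a) * f a)"
  using assms by (intro eq_matI) (auto simp: col_diag_matrix scalar_prod_right_unit mult.commute)

lemma diag_matrix_mult:
  fixes J :: "'a :: comm_semiring_1 mat"
  assumes "J \<in> carrier_mat r n"
  shows "diag_matrix r f * J = mat r n (\<lambda>(a, k). f a * J $$ (a, k))"
  using assms by (intro eq_matI) (auto simp: row_diag_matrix scalar_prod_left_unit)

lemma diag_matrix_mult_unit_vec:
  fixes f :: "nat \<Rightarrow> 'a :: semiring_1"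
  assumes "a < r"
  shows "diag_matrix r f *\<^sub>v unit_vec r a = f a \<cdot>\<^sub>v unit_vec r a"
  using assms by (simp add: mult_unit_vec_eq_col[of _ r r] col_diag_matrix)

lemma diag_matrix_mult_vec_index:
  fixes f :: "nat \<Rightarrow> 'a :: comm_semiring_1"
  assumes "b < r" "w \<in> carrier_vec r"
  shows "(diag_matrix r f *\<^sub>v w) $ b = f b * w $ b"
  using assms by (simp add: row_diag_matrix scalar_prod_left_unit carrier_vecD)

lemma adhm_act_eq_mult:
  assumes "I \<in> carrier_mat n r" "J \<in> carrier_mat r n"
  shows "adhm_act r n (t1, t2, u) (B1, B2, I, J) =
    (t1 \<cdot>\<^sub>m B1, t2 \<cdot>\<^sub>m B2, I * diag_matrix r (\<lambda>a. inverse (u a)), diag_matrix r (\<lambda>a. t1 * t2 * u a) * J)"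
  using assms by (simp add: adhm_act_def mult_diag_matrix diag_matrix_mult)

lemma cyc_act_eq_mult:
  assumes "I \<in> carrier_mat n r" "J \<in> carrier_mat r n"
  shows "cyc_act r n t1 t2 t3 (B1, B2, B3, I, J) =
    (t1 \<cdot>\<^sub>m B1, t2 \<cdot>\<^sub>m B2, t3 \<cdot>\<^sub>m B3, I * diag_matrix r (\<lambda>a. t3 ^ a),
     diag_matrix r (\<lambda>a. t1 * t2 * inverse (t3 ^ a)) * J)"
  using assms by (simp add: cyc_act_def mult_diag_matrix diag_matrix_mult mult.commute)

lemma framed_equiv_scale:
  assumes xy: "framed_equiv n (Bs, I, J) (Bs', I', J')"
    and x: "framed_carrier r n (Bs, I, J)" and y: "framed_carrier r n (Bs', I', J')"
    and D: "D \<in> carrier_mat r r" and E: "E \<in> carrier_mat r r"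
  shows "framed_equiv n (map2 (\<lambda>t B. t \<cdot>\<^sub>m B) ts Bs, I * D, E * J) (map2 (\<lambda>t B. t \<cdot>\<^sub>m B) ts Bs', I' * D, E * J')"
proof -
  obtain g where g: "g \<in> carrier_mat n n" "invertible_mat g" "list_all2 (\<lambda>B B'. B' * g = g * B) Bs Bs'"
    "I' = g * I" "J' * g = J"
    using xy by (auto simp: framed_equiv_def)
  have c: "set Bs \<subseteq> carrier_mat n n" "set Bs' \<subseteq> carrier_mat n n" "I \<in> carrier_mat n r" "J' \<in> carrier_mat r n"
    using x y by (auto simp: framed_carrier_def)
  have "list_all2 (\<lambda>B B'. B' * g = g * B) (map2 (\<lambda>t B. t \<cdot>\<^sub>m B) ts Bs) (map2 (\<lambda>t B. t \<cdot>\<^sub>m B) ts Bs')"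
  proof (unfold list_all2_conv_all_nth, intro conjI allI impI)
    show "length (map2 (\<lambda>t B. t \<cdot>\<^sub>m B) ts Bs) = length (map2 (\<lambda>t B. t \<cdot>\<^sub>m B) ts Bs')"
      using g(3) by (simp add: list_all2_lengthD)
    fix i assume "i < length (map2 (\<lambda>t B. t \<cdot>\<^sub>m B) ts Bs)"
    then have i: "i < length ts" "i < length Bs" "i < length Bs'" using g(3) by (simp_all add: list_all2_lengthD)
    have B: "Bs ! i \<in> carrier_mat n n" "Bs' ! i \<in> carrier_mat n n" using c(1,2) i nth_mem by blast+
    have "Bs' ! i * g = g * Bs ! i" using g(3) i by (simp add: list_all2_conv_all_nth)
    then show "map2 (\<lambda>t B. t \<cdot>\<^sub>m B) ts Bs' ! i * g = g * map2 (\<lambda>t B. t \<cdot>\<^sub>m B) ts Bs ! i"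
      using i B g(1) by (simp add: mult_smult_assoc_mat[of _ n n _ n] mult_smult_distrib[of _ n n _ n])
  qed
  moreover have "I' * D = g * (I * D)" using g(1,4) c(3) D by (simp add: assoc_mult_mat[of _ n n _ r _ r])
  moreover have "E * J' * g = E * J" using g(1,5) c(4) E by (simp add: assoc_mult_mat[of _ r r _ n _ n])
  ultimately show ?thesis using g(1,2) by (auto simp: framed_equiv_def)
qed

lemma adhm_act_carrier:
  "framed_carrier r n (adhm_framed x) \<Longrightarrow> framed_carrier r n (adhm_framed (adhm_act r n t x))"
  by (auto simp: framed_carrier_def adhm_framed_def adhm_act_def split: prod.splits)

lemma cyc_act_carrier:
  "framed_carrier r n (cyc_framed x) \<Longrightarrow> framed_carrier r n (cyc_framed (cyc_act r n t1 t2 t3 x))"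
  by (auto simp: framed_carrier_def cyc_framed_def cyc_act_def split: prod.splits)

lemma adhm_act_equiv:
  assumes x: "framed_carrier r n (adhm_framed x)" and y: "framed_carrier r n (adhm_framed y)"
    and xy: "adhm_equiv n x y"
  shows "adhm_equiv n (adhm_act r n t x) (adhm_act r n t y)"
proof -
  obtain B1 B2 I J B1' B2' I' J' t1 t2 u where eq: "x = (B1, B2, I, J)" "y = (B1', B2', I', J')" "t = (t1, t2, u)"
    by (cases x, cases y, cases t) auto
  have "I \<in> carrier_mat n r" "J \<in> carrier_mat r n" "I' \<in> carrier_mat n r" "J' \<in> carrier_mat r n"
    using x y by (auto simp: framed_carrier_def adhm_framed_def eq)
  then show ?thesis
    using framed_equiv_scale[of n "[B1, B2]" I J "[B1', B2']" I' J' r, where ts = "[t1, t2]"] x y xy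
    by (simp add: eq adhm_act_eq_mult adhm_equiv_iff_framed adhm_framed_def)
qed

lemma cyc_act_equiv:
  assumes x: "framed_carrier r n (cyc_framed x)" and y: "framed_carrier r n (cyc_framed y)"
    and xy: "cyc_equiv n x y"
  shows "cyc_equiv n (cyc_act r n t1 t2 t3 x) (cyc_act r n t1 t2 t3 y)"
proof -
  obtain B1 B2 B3 I J B1' B2' B3' I' J' where eq: "x = (B1, B2, B3, I, J)" "y = (B1', B2', B3', I', J')"
    by (cases x, cases y) auto
  have "I \<in> carrier_mat n r" "J \<in> carrier_mat r n" "I' \<in> carrier_mat n r" "J' \<in> carrier_mat r n"
    using x y by (auto simp: framed_carrier_def cyc_framed_def eq)
  then show ?thesis
    using framed_equiv_scale[of n "[B1, B2, B3]" I J "[B1', B2', B3']" I' J' r, where ts = "[t1, t2, t3]"] x y xy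
    by (simp add: eq cyc_act_eq_mult cyc_equiv_iff_framed cyc_framed_def)
qed

lemma adhm_act_inverse:
  assumes x: "framed_carrier r n (adhm_framed x)" and t: "(t1, t2, u) \<in> big_torus r"
  shows "adhm_act r n (t1, t2, u) (adhm_act r n (inverse t1, inverse t2, \<lambda>a. inverse (u a)) x) = x"
proof -
  obtain B1 B2 I J where eq: "x = (B1, B2, I, J)" by (cases x) auto
  have c: "B1 \<in> carrier_mat n n" "B2 \<in> carrier_mat n n" "I \<in> carrier_mat n r" "J \<in> carrier_mat r n"
    using x by (auto simp: framed_carrier_def adhm_framed_def eq)
  have t': "t1 \<noteq> 0" "t2 \<noteq> 0" "\<And>a. a < r \<Longrightarrow> u a \<noteq> 0" using t by (auto simp: big_torus_def)
  show ?thesis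
    unfolding eq adhm_act_def using t' c by (auto intro!: eq_matI simp: field_simps)
qed

lemma cyc_act_inverse:
  assumes x: "framed_carrier r n (cyc_framed x)" and t: "t1 \<noteq> 0" "t2 \<noteq> 0" "t3 \<noteq> 0"
  shows "cyc_act r n t1 t2 t3 (cyc_act r n (inverse t1) (inverse t2) (inverse t3) x) = x"
proof -
  obtain B1 B2 B3 I J where eq: "x = (B1, B2, B3, I, J)" by (cases x) auto
  have c: "B1 \<in> carrier_mat n n" "B2 \<in> carrier_mat n n" "B3 \<in> carrier_mat n n" "I \<in> carrier_mat n r"
    "J \<in> carrier_mat r n"
    using x by (auto simp: framed_carrier_def cyc_framed_def eq)
  show ?thesis
    unfolding eq cyc_act_def using t c by (auto intro!: eq_matI simp: field_simps power_inverse)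
qed

lemma adhm_act_image_class_subset:
  assumes x: "adhm_data r n x" and fixed: "adhm_equiv n x (adhm_act r n t x)"
  shows "adhm_act r n t ` adhm_class r n x \<subseteq> adhm_class r n x"
proof
  fix z assume "z \<in> adhm_act r n t ` adhm_class r n x"
  then obtain y where y: "adhm_data r n y" "adhm_equiv n x y" and z: "z = adhm_act r n t y"
    unfolding adhm_class_def by auto
  note c = adhm_data_carrier[OF x] adhm_data_carrier[OF y(1)]
  have "adhm_equiv n (adhm_act r n t x) z" unfolding z by (rule adhm_act_equiv[OF c y(2)])
  then have xz: "adhm_equiv n x z"
    using framed_equiv_trans[OF c(1) adhm_act_carrier[OF c(1)] adhm_act_carrier[OF c(2)]] fixed z
    unfolding adhm_equiv_iff_framed by blast
  then have "adhm_data r n z" using adhm_data_transport[OF x adhm_act_carrier[OF c(2)]] z by blast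
  then show "z \<in> adhm_class r n x" using xz unfolding adhm_class_def by simp
qed

lemma cyc_act_image_class_subset:
  assumes x: "cyc_data r n x" and fixed: "cyc_equiv n x (cyc_act r n t1 t2 t3 x)"
  shows "cyc_act r n t1 t2 t3 ` cyc_class r n x \<subseteq> cyc_class r n x"
proof
  fix z assume "z \<in> cyc_act r n t1 t2 t3 ` cyc_class r n x"
  then obtain y where y: "cyc_data r n y" "cyc_equiv n x y" and z: "z = cyc_act r n t1 t2 t3 y"
    unfolding cyc_class_def by auto
  note c = cyc_data_carrier[OF x] cyc_data_carrier[OF y(1)]
  have "cyc_equiv n (cyc_act r n t1 t2 t3 x) z" unfolding z by (rule cyc_act_equiv[OF c y(2)])
  then have xz: "cyc_equiv n x z"
    using framed_equiv_trans[OF c(1) cyc_act_carrier[OF c(1)] cyc_act_carrier[OF c(2)]] fixed z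
    unfolding cyc_equiv_iff_framed by blast
  then have "cyc_data r n z" using cyc_data_transport[OF x cyc_act_carrier[OF c(2)]] z by blast
  then show "z \<in> cyc_class r n x" using xz unfolding cyc_class_def by simp
qed

lemma adhm_act_image_class:
  assumes x: "adhm_data r n x" and t: "t \<in> big_torus r"
    and fixed: "\<And>t. t \<in> big_torus r \<Longrightarrow> adhm_equiv n x (adhm_act r n t x)"
  shows "adhm_act r n t ` adhm_class r n x = adhm_class r n x"
proof
  obtain t1 t2 u where t_eq: "t = (t1, t2, u)" by (cases t) auto
  let ?t' = "(inverse t1, inverse t2, \<lambda>a. inverse (u a))"
  have t': "?t' \<in> big_torus r" using t t_eq by (auto simp: big_torus_def)
  show "adhm_act r n t ` adhm_class r n x \<subseteq> adhm_class r n x"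
    by (rule adhm_act_image_class_subset[OF x fixed[OF t]])
  show "adhm_class r n x \<subseteq> adhm_act r n t ` adhm_class r n x"
  proof
    fix y assume y: "y \<in> adhm_class r n x"
    then have "y = adhm_act r n t (adhm_act r n ?t' y)"
      using adhm_act_inverse[OF adhm_data_carrier] t t_eq by (simp add: adhm_class_def)
    moreover have "adhm_act r n ?t' y \<in> adhm_class r n x"
      using adhm_act_image_class_subset[OF x fixed[OF t']] y by blast
    ultimately show "y \<in> adhm_act r n t ` adhm_class r n x" by blast
  qed
qed

lemma cyc_act_image_class:
  assumes x: "cyc_data r n x" and t: "t1 \<noteq> 0" "t2 \<noteq> 0" "t3 \<noteq> 0"
    and fixed: "\<And>t1 t2 t3. t1 \<noteq> 0 \<Longrightarrow> t2 \<noteq> 0 \<Longrightarrow> t3 \<noteq> 0 \<Longrightarrow> cyc_equiv n x (cyc_act r n t1 t2 t3 x)"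
  shows "cyc_act r n t1 t2 t3 ` cyc_class r n x = cyc_class r n x"
proof
  show "cyc_act r n t1 t2 t3 ` cyc_class r n x \<subseteq> cyc_class r n x"
    by (rule cyc_act_image_class_subset[OF x fixed[OF t]])
  show "cyc_class r n x \<subseteq> cyc_act r n t1 t2 t3 ` cyc_class r n x"
  proof
    fix y assume y: "y \<in> cyc_class r n x"
    then have "y = cyc_act r n t1 t2 t3 (cyc_act r n (inverse t1) (inverse t2) (inverse t3) y)"
      using cyc_act_inverse[OF cyc_data_carrier] t by (simp add: cyc_class_def)
    moreover have "cyc_act r n (inverse t1) (inverse t2) (inverse t3) y \<in> cyc_class r n x"
      using cyc_act_image_class_subset[OF x fixed[of "inverse t1" "inverse t2" "inverse t3"]] t y by auto
    ultimately show "y \<in> cyc_act r n t1 t2 t3 ` cyc_class r n x" by blast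
  qed
qed

lemma adhm_equiv_act_of_fixed_class:
  assumes "adhm_data r n x" "adhm_act r n t ` adhm_class r n x = adhm_class r n x"
  shows "adhm_equiv n x (adhm_act r n t x)"
  using assms adhm_mem_class[OF assms(1)] unfolding adhm_class_def by blast

lemma cyc_equiv_act_of_fixed_class:
  assumes x: "cyc_data r n x" and fixed: "cyc_act r n t1 t2 t3 ` cyc_class r n x = cyc_class r n x"
    and y: "y \<in> cyc_class r n x"
  shows "cyc_equiv n y (cyc_act r n t1 t2 t3 y)"
proof -
  have y': "cyc_data r n y" "cyc_equiv n x y" using y by (auto simp: cyc_class_def)
  have z: "cyc_data r n (cyc_act r n t1 t2 t3 y)" "cyc_equiv n x (cyc_act r n t1 t2 t3 y)"
    using fixed y by (auto simp: cyc_class_def)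
  note c = cyc_data_carrier[OF x] cyc_data_carrier[OF y'(1)] cyc_data_carrier[OF z(1)]
  show ?thesis
    using framed_equiv_trans[OF c(2,1,3) framed_equiv_sym[OF c(1,2)]] y'(2) z(2)
    unfolding cyc_equiv_iff_framed by blast
qed

section \<open>Monomials and the fixed points \<open>\<alpha>\<^sub>\<mu>\<close>\<close>

definition young_family :: "nat \<Rightarrow> (nat \<Rightarrow> (nat \<times> nat) set) \<Rightarrow> bool" where
  "young_family r \<mu> \<longleftrightarrow> (\<forall>a<r. young (\<mu> a)) \<and> (\<forall>a\<ge>r. \<mu> a = {})"

lemma cells_eq_Sigma: "cells r \<mu> = Sigma {..<r} \<mu>"
  by (auto simp: cells_def)

lemma mem_cells: "(a, i, j) \<in> cells r \<mu> \<longleftrightarrow> a < r \<and> (i, j) \<in> \<mu> a"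
  by (simp add: cells_def)

lemma r_partitions_iff: "\<mu> \<in> r_partitions r n \<longleftrightarrow> young_family r \<mu> \<and> card (cells r \<mu>) = n"
  by (auto simp: r_partitions_def young_family_def cells_eq_Sigma young_def)

definition x_shift :: "nat \<times> nat \<times> nat \<Rightarrow> nat \<times> nat \<times> nat" where
  "x_shift = (\<lambda>(a, i, j). (a, Suc i, j))"

definition y_shift :: "nat \<times> nat \<times> nat \<Rightarrow> nat \<times> nat \<times> nat" where
  "y_shift = (\<lambda>(a, i, j). (a, i, Suc j))"

definition summand_shift :: "nat \<times> nat \<times> nat \<Rightarrow> nat \<times> nat \<times> nat" where
  "summand_shift = (\<lambda>(a, i, j). (Suc a, i, j))"

definition alpha_B3 :: "nat \<Rightarrow> nat \<Rightarrow> (nat \<Rightarrow> (nat \<times> nat) set) \<Rightarrow> complex mat" where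
  "alpha_B3 r n \<mu> = (let L = sorted_list_of_set (cells r \<mu>) in
     mat n n (\<lambda>(k, l). if L ! k = summand_shift (L ! l) then 1 else 0))"

definition alphaQ_data :: "nat \<Rightarrow> nat \<Rightarrow> (nat \<Rightarrow> (nat \<times> nat) set) \<Rightarrow> cycrep" where
  "alphaQ_data r n \<mu> = (case alpha_data r n \<mu> of (B1, B2, I, J) \<Rightarrow> (B1, B2, alpha_B3 r n \<mu>, I, J))"

lemma forget_B3_alphaQ_data: "forget_B3 (alphaQ_data r n \<mu>) = alpha_data r n \<mu>"
  by (simp add: alphaQ_data_def forget_B3_def alpha_data_def Let_def)

definition monomial :: "nat \<Rightarrow> complex mat \<Rightarrow> complex mat \<Rightarrow> complex mat \<Rightarrow> nat \<times> nat \<times> nat \<Rightarrow> complex vec" where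
  "monomial r B1 B2 I = (\<lambda>(a, i, j).
     if a < r then B1 ^\<^sub>m i *\<^sub>v (B2 ^\<^sub>m j *\<^sub>v col I a) else 0\<^sub>v (dim_row I))"

definition monomial_partition :: "nat \<Rightarrow> complex mat \<Rightarrow> complex mat \<Rightarrow> complex mat \<Rightarrow> nat \<Rightarrow> (nat \<times> nat) set" where
  "monomial_partition r B1 B2 I a = {(i, j). a < r \<and> monomial r B1 B2 I (a, i, j) \<noteq> 0\<^sub>v (dim_row I)}"

lemma monomial_carrier:
  assumes "B1 \<in> carrier_mat n n" "B2 \<in> carrier_mat n n" "I \<in> carrier_mat n r"
  shows "monomial r B1 B2 I c \<in> carrier_vec n"
  using assms by (auto simp: monomial_def split: prod.splits intro!: mult_mat_vec_carrier[of _ n n])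

lemma monomial_conj:
  assumes g: "g \<in> carrier_mat n n" and c: "B1 \<in> carrier_mat n n" "B2 \<in> carrier_mat n n"
    "B1' \<in> carrier_mat n n" "B2' \<in> carrier_mat n n" "I \<in> carrier_mat n r"
    and conj: "B1' * g = g * B1" "B2' * g = g * B2"
  shows "monomial r B1' B2' (g * I) c = g *\<^sub>v monomial r B1 B2 I c"
proof -
  obtain a i j where c_eq: "c = (a, i, j)" by (cases c) auto
  have "B1' ^\<^sub>m i *\<^sub>v (B2' ^\<^sub>m j *\<^sub>v (g *\<^sub>v col I a)) = g *\<^sub>v (B1 ^\<^sub>m i *\<^sub>v (B2 ^\<^sub>m j *\<^sub>v col I a))"
    if "a < r"
  proof -
    have col: "col I a \<in> carrier_vec n" using c(5) by simp
    then show ?thesis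
      using pow_mat_mult_vec_intertwine[OF c(4) g c(2) conj(2) col]
        pow_mat_mult_vec_intertwine[OF c(3) g c(1) conj(1) mult_mat_vec_carrier[OF pow_carrier_mat[OF c(2)] col]]
      by simp
  qed
  then show ?thesis using g c by (auto simp: monomial_def c_eq col_mult2)
qed

lemma monomial_partition_conj:
  assumes g: "g \<in> carrier_mat n n" "invertible_mat g" and c: "B1 \<in> carrier_mat n n" "B2 \<in> carrier_mat n n"
    "B1' \<in> carrier_mat n n" "B2' \<in> carrier_mat n n" "I \<in> carrier_mat n r"
    and conj: "B1' * g = g * B1" "B2' * g = g * B2"
  shows "monomial_partition r B1' B2' (g * I) = monomial_partition r B1 B2 I"
  using monomial_conj[OF g(1) c conj] invertible_mat_mult_vec_eq_zero_iff[OF g monomial_carrier[OF c(1,2,5)]]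
    g(1) c(5) by (auto simp: monomial_partition_def fun_eq_iff)

lemma pow_mat_mult_vec_mem_invariant:
  assumes S: "vsubspace n S" and B: "B \<in> carrier_mat n n" and inv: "\<And>v. v \<in> S \<Longrightarrow> B *\<^sub>v v \<in> S"
    and v: "v \<in> S"
  shows "B ^\<^sub>m k *\<^sub>v v \<in> S"
  using v
proof (induction k arbitrary: v)
  case 0
  then show ?case using vsubspace_carrier[OF S] B by auto
next
  case (Suc k)
  have "B ^\<^sub>m Suc k *\<^sub>v v = B ^\<^sub>m k *\<^sub>v (B *\<^sub>v v)"
    using assoc_mult_mat_vec[OF pow_carrier_mat[OF B] B] Suc.prems vsubspace_carrier[OF S] by auto
  then show ?case using Suc.IH inv Suc.prems by simp
qed

lemma monomial_mem_invariant:
  assumes S: "vsubspace n S" and c: "B1 \<in> carrier_mat n n" "B2 \<in> carrier_mat n n" "I \<in> carrier_mat n r"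
    and inv: "\<And>v. v \<in> S \<Longrightarrow> B1 *\<^sub>v v \<in> S" "\<And>v. v \<in> S \<Longrightarrow> B2 *\<^sub>v v \<in> S"
    and I: "\<And>w. w \<in> carrier_vec r \<Longrightarrow> I *\<^sub>v w \<in> S"
  shows "monomial r B1 B2 I x \<in> S"
proof -
  obtain a i j where x: "x = (a, i, j)" by (cases x) auto
  have "col I a \<in> S" if "a < r"
    using I[of "unit_vec r a"] mult_unit_vec_eq_col[OF c(3) that] by simp
  then show ?thesis
    using pow_mat_mult_vec_mem_invariant[OF S c(1) inv(1)] pow_mat_mult_vec_mem_invariant[OF S c(2) inv(2)]
      vsubspace_zero[OF S] c(3) by (auto simp: monomial_def x)
qed

locale cell_basis =
  fixes r :: nat and \<mu> :: "nat \<Rightarrow> (nat \<times> nat) set"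
  assumes young_family: "young_family r \<mu>"
begin

abbreviation "C \<equiv> cells r \<mu>"
abbreviation "N \<equiv> card (cells r \<mu>)"
abbreviation "L \<equiv> sorted_list_of_set (cells r \<mu>)"

lemma finite_C: "finite C"
  using young_family by (auto simp: young_family_def young_def cells_eq_Sigma)

lemma length_L: "length L = N"
  using finite_C by simp

lemma L_nth_mem: "k < N \<Longrightarrow> L ! k \<in> C"
  using finite_C nth_mem length_L by (metis set_sorted_list_of_set)

lemma L_nth_eq_iff: "k < N \<Longrightarrow> l < N \<Longrightarrow> L ! k = L ! l \<longleftrightarrow> k = l"
  using length_L nth_eq_iff_index_eq distinct_sorted_list_of_set by metis

lemma C_eq_L_nth: "c \<in> C \<Longrightarrow> \<exists>l<N. L ! l = c"
  using finite_C length_L by (metis in_set_conv_nth set_sorted_list_of_set)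

lemma young_closed: "(a, Suc i, j) \<in> C \<or> (a, i, Suc j) \<in> C \<Longrightarrow> (a, i, j) \<in> C"
  using young_family unfolding young_family_def young_def cells_def
  by (metis (no_types, lifting) case_prod_conv le_Suc_eq le_refl mem_Collect_eq)

definition cell_vec :: "nat \<times> nat \<times> nat \<Rightarrow> complex vec" where
  "cell_vec c = vec N (\<lambda>k. if L ! k = c then 1 else 0)"

lemma cell_vec_carrier [simp]: "cell_vec c \<in> carrier_vec N"
  by (simp add: cell_vec_def)

lemma cell_vec_L_nth: "l < N \<Longrightarrow> cell_vec (L ! l) = unit_vec N l"
  unfolding cell_vec_def by (intro eq_vecI) (auto simp: L_nth_eq_iff unit_vec_def)

lemma cell_vec_eq_zero: "c \<notin> C \<Longrightarrow> cell_vec c = 0\<^sub>v N"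
  unfolding cell_vec_def by (intro eq_vecI) (use L_nth_mem in auto)

lemma cell_vec_eq_zero_iff: "cell_vec c = 0\<^sub>v N \<longleftrightarrow> c \<notin> C"
proof
  assume "cell_vec c = 0\<^sub>v N"
  then show "c \<notin> C" using C_eq_L_nth cell_vec_L_nth unit_vec_nonzero by (metis less_irrefl_nat)
qed (rule cell_vec_eq_zero)

lemma mat_eqI_cell_vec:
  fixes X Y :: "complex mat"
  assumes "X \<in> carrier_mat m N" "Y \<in> carrier_mat m N" "\<And>c. c \<in> C \<Longrightarrow> X *\<^sub>v cell_vec c = Y *\<^sub>v cell_vec c"
  shows "X = Y"
  using assms by (intro mat_eqI_unit_vec[of _ m N]) (auto simp: cell_vec_L_nth[symmetric] L_nth_mem)

text \<open>The conclusion is also right when \<open>f c\<close> is not a cell, \<^term>\<open>cell_vec\<close> being zero there.\<close>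

lemma mult_cell_vec_eq:
  fixes X :: "complex mat"
  assumes X: "X \<in> carrier_mat N N" "\<And>k l. k < N \<Longrightarrow> l < N \<Longrightarrow> X $$ (k, l) = (if L ! k = f (L ! l) then 1 else 0)"
    and c: "c \<in> C"
  shows "X *\<^sub>v cell_vec c = cell_vec (f c)"
proof -
  obtain l where l: "l < N" "L ! l = c" using C_eq_L_nth[OF c] by auto
  have "X *\<^sub>v cell_vec c = col X l" using cell_vec_L_nth[OF l(1)] l X(1) by (simp add: mult_unit_vec_eq_col)
  also have "\<dots> = cell_vec (f c)" using X l unfolding cell_vec_def by (intro eq_vecI) auto
  finally show ?thesis .
qed

definition "mu_B1 = fst (alpha_data r N \<mu>)"
definition "mu_B2 = fst (snd (alpha_data r N \<mu>))"
definition "mu_I = fst (snd (snd (alpha_data r N \<mu>)))"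
definition "mu_B3 = alpha_B3 r N \<mu>"

lemma alpha_data_eq: "alpha_data r N \<mu> = (mu_B1, mu_B2, mu_I, 0\<^sub>m r N)"
  unfolding mu_B1_def mu_B2_def mu_I_def alpha_data_def Let_def by simp

lemma alphaQ_data_eq: "alphaQ_data r N \<mu> = (mu_B1, mu_B2, mu_B3, mu_I, 0\<^sub>m r N)"
  unfolding alphaQ_data_def alpha_data_eq mu_B3_def by simp

lemma mu_carrier [simp]:
  "mu_B1 \<in> carrier_mat N N" "mu_B2 \<in> carrier_mat N N" "mu_B3 \<in> carrier_mat N N" "mu_I \<in> carrier_mat N r"
  by (simp_all add: mu_B1_def mu_B2_def mu_B3_def mu_I_def alpha_data_def alpha_B3_def Let_def)

lemma mu_index:
  assumes "k < N" "l < N"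
  shows "mu_B1 $$ (k, l) = (if L ! k = x_shift (L ! l) then 1 else 0)"
    and "mu_B2 $$ (k, l) = (if L ! k = y_shift (L ! l) then 1 else 0)"
    and "mu_B3 $$ (k, l) = (if L ! k = summand_shift (L ! l) then 1 else 0)"
proof -
  obtain a i j where "L ! l = (a, i, j)" by (cases "L ! l") auto
  then show "mu_B1 $$ (k, l) = (if L ! k = x_shift (L ! l) then 1 else 0)"
    and "mu_B2 $$ (k, l) = (if L ! k = y_shift (L ! l) then 1 else 0)"
    and "mu_B3 $$ (k, l) = (if L ! k = summand_shift (L ! l) then 1 else 0)"
    using assms by (simp_all add: mu_B1_def mu_B2_def mu_B3_def alpha_data_def alpha_B3_def Let_def
        x_shift_def y_shift_def)
qed

lemma mu_B1_cell_vec: "mu_B1 *\<^sub>v cell_vec c = cell_vec (x_shift c)"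
proof (cases "c \<in> C")
  case True
  show ?thesis
    by (rule mult_cell_vec_eq[OF mu_carrier(1) mu_index(1) True])
next
  case False
  obtain a i j where c: "c = (a, i, j)" by (cases c) auto
  have "x_shift c \<notin> C" using False young_closed[of a i j] by (auto simp: c x_shift_def)
  then show ?thesis using False by (simp add: cell_vec_eq_zero)
qed

lemma mu_B2_cell_vec: "mu_B2 *\<^sub>v cell_vec c = cell_vec (y_shift c)"
proof (cases "c \<in> C")
  case True
  show ?thesis
    by (rule mult_cell_vec_eq[OF mu_carrier(2) mu_index(2) True])
next
  case False
  obtain a i j where c: "c = (a, i, j)" by (cases c) auto
  have "y_shift c \<notin> C" using False young_closed[of a i j] by (auto simp: c y_shift_def)
  then show ?thesis using False by (simp add: cell_vec_eq_zero)
qed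

lemma mu_B3_cell_vec:
  assumes "nested r \<mu>"
  shows "mu_B3 *\<^sub>v cell_vec c = cell_vec (summand_shift c)"
proof (cases "c \<in> C")
  case True
  show ?thesis by (rule mult_cell_vec_eq[OF mu_carrier(3) mu_index(3) True])
next
  case False
  then have "summand_shift c \<notin> C"
    using assms by (auto simp: summand_shift_def cells_def nested_def split: prod.splits)
  then show ?thesis using False by (simp add: cell_vec_eq_zero)
qed

lemma mu_I_unit_vec: "a < r \<Longrightarrow> mu_I *\<^sub>v unit_vec r a = cell_vec (a, 0, 0)"
  by (simp add: mult_unit_vec_eq_col[of _ N r] cell_vec_def mu_I_def alpha_data_def Let_def)

lemma pow_mu_B1_cell_vec: "mu_B1 ^\<^sub>m k *\<^sub>v cell_vec (a, i, j) = cell_vec (a, i + k, j)"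
proof (induction k arbitrary: i)
  case (Suc k)
  have "mu_B1 ^\<^sub>m Suc k *\<^sub>v cell_vec (a, i, j) = mu_B1 ^\<^sub>m k *\<^sub>v (mu_B1 *\<^sub>v cell_vec (a, i, j))"
    using assoc_mult_mat_vec[OF pow_carrier_mat[of _ N] mu_carrier(1) cell_vec_carrier] by simp
  then show ?case using Suc[of "Suc i"] by (simp add: mu_B1_cell_vec x_shift_def)
qed (simp add: carrier_matD[OF mu_carrier(1)])

lemma pow_mu_B2_cell_vec: "mu_B2 ^\<^sub>m k *\<^sub>v cell_vec (a, i, j) = cell_vec (a, i, j + k)"
proof (induction k arbitrary: j)
  case (Suc k)
  have "mu_B2 ^\<^sub>m Suc k *\<^sub>v cell_vec (a, i, j) = mu_B2 ^\<^sub>m k *\<^sub>v (mu_B2 *\<^sub>v cell_vec (a, i, j))"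
    using assoc_mult_mat_vec[OF pow_carrier_mat[of _ N] mu_carrier(2) cell_vec_carrier] by simp
  then show ?case using Suc[of "Suc j"] by (simp add: mu_B2_cell_vec y_shift_def)
qed (simp add: carrier_matD[OF mu_carrier(2)])

lemma monomial_mu: "monomial r mu_B1 mu_B2 mu_I c = cell_vec c"
proof -
  obtain a i j where c: "c = (a, i, j)" by (cases c) auto
  show ?thesis
  proof (cases "a < r")
    case True
    then have "col mu_I a = cell_vec (a, 0, 0)" using mu_I_unit_vec mult_unit_vec_eq_col[of mu_I N r] by simp
    then show ?thesis using True by (simp add: monomial_def c pow_mu_B1_cell_vec pow_mu_B2_cell_vec)
  next
    case False
    then have "c \<notin> C" by (simp add: c cells_def)
    then show ?thesis using False by (simp add: monomial_def c cell_vec_eq_zero carrier_matD[OF mu_carrier(4)])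
  qed
qed

lemma monomial_partition_mu: "monomial_partition r mu_B1 mu_B2 mu_I = \<mu>"
proof
  fix a show "monomial_partition r mu_B1 mu_B2 mu_I a = \<mu> a"
  proof (cases "a < r")
    case True
    then show ?thesis
      by (auto simp: monomial_partition_def monomial_mu cell_vec_eq_zero_iff carrier_matD[OF mu_carrier(4)]
          mem_cells)
  next
    case False
    then show ?thesis using young_family by (auto simp: monomial_partition_def young_family_def)
  qed
qed

lemma mu_B1_B2_commute: "mu_B1 * mu_B2 = mu_B2 * mu_B1"
  by (rule mat_eqI_cell_vec[of _ N])
     (auto simp: mult_carrier_mat[of _ N N _ N] assoc_mult_mat_vec[of _ N N _ N] mu_B1_cell_vec mu_B2_cell_vec
        x_shift_def y_shift_def split: prod.splits)


lemma mu_stable: "stable_wrt r N [mu_B1, mu_B2] mu_I"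
proof (rule stable_wrtI)
  fix S assume S: "vsubspace N S" and inv: "\<And>B v. B \<in> set [mu_B1, mu_B2] \<Longrightarrow> v \<in> S \<Longrightarrow> B *\<^sub>v v \<in> S"
    and I: "\<And>w. w \<in> carrier_vec r \<Longrightarrow> mu_I *\<^sub>v w \<in> S"
  have "cell_vec c \<in> S" for c
    using monomial_mem_invariant[OF S mu_carrier(1,2,4) _ _ I, of c] inv monomial_mu by simp
  then show "S = carrier_vec N"
    using cell_vec_L_nth by (intro vsubspace_eq_carrier_vecI[OF S]) metis
qed

lemma alpha_data_adhm_data: "adhm_data r N (alpha_data r N \<mu>)"
proof -
  have "mu_B1 * mu_B2 + mu_I * 0\<^sub>m r N = mu_B2 * mu_B1"
    using mu_B1_B2_commute right_mult_zero_mat[OF mu_carrier(4)] by (simp add: mult_carrier_mat[of _ N N _ N])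
  then show ?thesis
    unfolding alpha_data_eq adhm_data_def using mu_stable adhm_relation_iff[OF mu_carrier(1,2,4)] by simp
qed

lemma mu_B3_commute:
  assumes "nested r \<mu>"
  shows "mu_B3 * mu_B1 = mu_B1 * mu_B3" "mu_B3 * mu_B2 = mu_B2 * mu_B3"
  by (rule mat_eqI_cell_vec[of _ N],
      auto simp: mult_carrier_mat[of _ N N _ N] assoc_mult_mat_vec[of _ N N _ N] mu_B1_cell_vec mu_B2_cell_vec
        mu_B3_cell_vec[OF assms] x_shift_def y_shift_def summand_shift_def split: prod.splits)+

lemma mu_B3_mu_I:
  assumes "nested r \<mu>"
  shows "mu_B3 * mu_I = mu_I * shift_mat r"
proof (rule mat_eqI_unit_vec[of _ N r])
  fix a assume a: "a < r"
  have "(mu_B3 * mu_I) *\<^sub>v unit_vec r a = cell_vec (Suc a, 0, 0)"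
    using a by (simp add: assoc_mult_mat_vec[of _ N N _ r] mu_I_unit_vec mu_B3_cell_vec[OF assms] summand_shift_def)
  also have "\<dots> = (mu_I * shift_mat r) *\<^sub>v unit_vec r a"
    using a by (simp add: assoc_mult_mat_vec[of _ N r _ r] shift_mat_unit_vec mu_I_unit_vec cell_vec_eq_zero
        mem_cells mult_mat_zero_vec[OF mu_carrier(4)])
  finally show "(mu_B3 * mu_I) *\<^sub>v unit_vec r a = (mu_I * shift_mat r) *\<^sub>v unit_vec r a" .
qed (simp_all add: mult_carrier_mat[of _ N N _ r] mult_carrier_mat[of _ N r _ r])

lemma alphaQ_data_cyc_data:
  assumes "nested r \<mu>"
  shows "cyc_data r N (alphaQ_data r N \<mu>)"
proof -
  have "mu_B1 * mu_B2 + mu_I * 0\<^sub>m r N = mu_B2 * mu_B1"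
    using mu_B1_B2_commute right_mult_zero_mat[OF mu_carrier(4)] by (simp add: mult_carrier_mat[of _ N N _ N])
  moreover have "0\<^sub>m r N * mu_B3 = shift_mat r * 0\<^sub>m r N"
    by (simp add: left_mult_zero_mat[of _ N N] right_mult_zero_mat[of _ r r])
  moreover have "stable_wrt r N [mu_B1, mu_B2, mu_B3] mu_I" by (rule stable_wrt_mono[OF mu_stable]) auto
  ultimately show ?thesis
    unfolding alphaQ_data_eq cyc_data_def
    using adhm_relation_iff[OF mu_carrier(1,2,4)] mu_B3_commute[OF assms] mu_B3_mu_I[OF assms] by simp
qed

definition weight_mat :: "(nat \<times> nat \<times> nat \<Rightarrow> complex) \<Rightarrow> complex mat" where
  "weight_mat w = diag_matrix N (\<lambda>k. w (L ! k))"

lemma weight_mat_carrier [simp]: "weight_mat w \<in> carrier_mat N N"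
  by (simp add: weight_mat_def)

lemma weight_mat_cell_vec: "weight_mat w *\<^sub>v cell_vec c = w c \<cdot>\<^sub>v cell_vec c"
proof (cases "c \<in> C")
  case True
  then obtain l where l: "l < N" "L ! l = c" using C_eq_L_nth by blast
  then show ?thesis unfolding weight_mat_def using cell_vec_L_nth diag_matrix_mult_unit_vec by metis
next
  case False
  then show ?thesis by (auto simp: cell_vec_eq_zero weight_mat_def)
qed

lemma invertible_weight_mat:
  assumes "\<And>c. c \<in> C \<Longrightarrow> w c \<noteq> 0"
  shows "invertible_mat (weight_mat w)"
proof -
  have "weight_mat w * weight_mat (\<lambda>c. inverse (w c)) = 1\<^sub>m N"
    "weight_mat (\<lambda>c. inverse (w c)) * weight_mat w = 1\<^sub>m N"
    by (rule mat_eqI_cell_vec[of _ N], use assms in \<open>auto simp: mult_carrier_mat[of _ N N _ N]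
        weight_mat_cell_vec assoc_mult_mat_vec[of _ N N _ N] mult_mat_vec[of _ N N] smult_smult_assoc
        cell_vec_eq_zero\<close>)+
  then show ?thesis using invertible_mat_iff_inverse[of "weight_mat w" N] weight_mat_carrier by blast
qed

lemma weight_mat_intertwine:
  assumes X: "X \<in> carrier_mat N N" and X_cell: "\<And>c. X *\<^sub>v cell_vec c = cell_vec (f c)"
    and w: "\<And>c. w (f c) = t * w c"
  shows "(t \<cdot>\<^sub>m X) * weight_mat w = weight_mat w * X"
proof (rule mat_eqI_cell_vec[of _ N])
  fix c
  have "((t \<cdot>\<^sub>m X) * weight_mat w) *\<^sub>v cell_vec c = t \<cdot>\<^sub>v (X *\<^sub>v (w c \<cdot>\<^sub>v cell_vec c))"
    using X by (simp add: assoc_mult_mat_vec[of _ N N _ N] smult_mat_mult_vec[of _ N N] weight_mat_cell_vec)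
  also have "\<dots> = (t * w c) \<cdot>\<^sub>v cell_vec (f c)" using X by (simp add: mult_mat_vec[of _ N N] X_cell smult_smult_assoc)
  also have "\<dots> = (weight_mat w * X) *\<^sub>v cell_vec c"
    using X by (simp add: assoc_mult_mat_vec[of _ N N _ N] X_cell weight_mat_cell_vec w)
  finally show "((t \<cdot>\<^sub>m X) * weight_mat w) *\<^sub>v cell_vec c = (weight_mat w * X) *\<^sub>v cell_vec c" .
qed (use X in \<open>auto simp: mult_carrier_mat[of _ N N _ N]\<close>)

text \<open>Rescaling the basis vector \<open>x\<^sup>i y\<^sup>j\<close> of summand \<open>a\<close> by the weight \<open>t\<^sub>1\<^sup>i t\<^sub>2\<^sup>j u\<^sub>a\<^sup>-\<^sup>1\<close>
  conjugates \<open>\<alpha>\<^sub>\<mu>\<close> into \<open>t \<cdot> \<alpha>\<^sub>\<mu>\<close>.\<close>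

lemma alpha_data_torus_fixed:
  assumes t: "t \<in> big_torus r"
  shows "adhm_equiv N (alpha_data r N \<mu>) (adhm_act r N t (alpha_data r N \<mu>))"
proof -
  obtain t1 t2 u where t_eq: "t = (t1, t2, u)" by (cases t) auto
  have t': "t1 \<noteq> 0" "t2 \<noteq> 0" "\<And>a. a < r \<Longrightarrow> u a \<noteq> 0" using t t_eq by (auto simp: big_torus_def)
  define w where "w = (\<lambda>(a, i, j). t1 ^ i * t2 ^ j * inverse (u a))"
  have "(t1 \<cdot>\<^sub>m mu_B1) * weight_mat w = weight_mat w * mu_B1"
    by (rule weight_mat_intertwine[OF _ mu_B1_cell_vec]) (auto simp: w_def x_shift_def split: prod.splits)
  moreover have "(t2 \<cdot>\<^sub>m mu_B2) * weight_mat w = weight_mat w * mu_B2"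
    by (rule weight_mat_intertwine[OF _ mu_B2_cell_vec]) (auto simp: w_def y_shift_def split: prod.splits)
  moreover have "mu_I * diag_matrix r (\<lambda>a. inverse (u a)) = weight_mat w * mu_I"
    by (rule mat_eqI_unit_vec[of _ N r])
      (auto simp: assoc_mult_mat_vec[of _ N r _ r] assoc_mult_mat_vec[of _ N N _ r] diag_matrix_mult_unit_vec
        mult_mat_vec[of _ N r] mu_I_unit_vec weight_mat_cell_vec w_def
        mult_carrier_mat[of _ N N _ r] mult_carrier_mat[of _ N r _ r])
  moreover have "invertible_mat (weight_mat w)"
    by (rule invertible_weight_mat) (use t' in \<open>auto simp: w_def cells_def\<close>)
  ultimately show ?thesis
    unfolding alpha_data_eq t_eq
    by (subst adhm_act_eq_mult) (auto simp: adhm_equiv_def intro!: bexI[of _ "weight_mat w"])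
qed

lemma alphaQ_data_torus_fixed:
  assumes nested: "nested r \<mu>" and t: "t1 \<noteq> 0" "t2 \<noteq> 0" "t3 \<noteq> 0"
  shows "cyc_equiv N (alphaQ_data r N \<mu>) (cyc_act r N t1 t2 t3 (alphaQ_data r N \<mu>))"
proof -
  define w where "w = (\<lambda>(a, i, j). t1 ^ i * t2 ^ j * t3 ^ a)"
  have "(t1 \<cdot>\<^sub>m mu_B1) * weight_mat w = weight_mat w * mu_B1"
    by (rule weight_mat_intertwine[OF _ mu_B1_cell_vec]) (auto simp: w_def x_shift_def split: prod.splits)
  moreover have "(t2 \<cdot>\<^sub>m mu_B2) * weight_mat w = weight_mat w * mu_B2"
    by (rule weight_mat_intertwine[OF _ mu_B2_cell_vec]) (auto simp: w_def y_shift_def split: prod.splits)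
  moreover have "(t3 \<cdot>\<^sub>m mu_B3) * weight_mat w = weight_mat w * mu_B3"
    by (rule weight_mat_intertwine[OF _ mu_B3_cell_vec[OF nested]])
      (auto simp: w_def summand_shift_def split: prod.splits)
  moreover have "mu_I * diag_matrix r (\<lambda>a. t3 ^ a) = weight_mat w * mu_I"
    by (rule mat_eqI_unit_vec[of _ N r])
      (auto simp: assoc_mult_mat_vec[of _ N r _ r] assoc_mult_mat_vec[of _ N N _ r] diag_matrix_mult_unit_vec
        mult_mat_vec[of _ N r] mu_I_unit_vec weight_mat_cell_vec w_def
        mult_carrier_mat[of _ N N _ r] mult_carrier_mat[of _ N r _ r])
  moreover have "invertible_mat (weight_mat w)"
    by (rule invertible_weight_mat) (use t in \<open>auto simp: w_def\<close>)
  ultimately show ?thesis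
    unfolding alphaQ_data_eq
    by (subst cyc_act_eq_mult) (auto simp: cyc_equiv_def intro!: bexI[of _ "weight_mat w"])
qed

end

lemma cell_basis_r_partition:
  assumes "\<mu> \<in> r_partitions r n"
  shows "cell_basis r \<mu>" and "card (cells r \<mu>) = n"
  using assms by (simp_all add: cell_basis_def r_partitions_iff)

lemma alpha_adhm_data: "\<mu> \<in> r_partitions r n \<Longrightarrow> adhm_data r n (alpha_data r n \<mu>)"
  using cell_basis.alpha_data_adhm_data cell_basis_r_partition by metis

lemma alphaQ_cyc_data: "\<mu> \<in> nested_partitions r n \<Longrightarrow> cyc_data r n (alphaQ_data r n \<mu>)"
  using cell_basis.alphaQ_data_cyc_data cell_basis_r_partition
  unfolding nested_partitions_def by (metis (mono_tags, lifting) mem_Collect_eq)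

lemma alpha_in_A_fixed_big:
  assumes \<mu>: "\<mu> \<in> r_partitions r n"
  shows "alpha r n \<mu> \<in> A_fixed_big r n"
proof -
  have "adhm_act r n t ` alpha r n \<mu> = alpha r n \<mu>" if "t \<in> big_torus r" for t
    unfolding alpha_def
    using adhm_act_image_class[OF alpha_adhm_data[OF \<mu>] that]
      cell_basis.alpha_data_torus_fixed[OF cell_basis_r_partition(1)[OF \<mu>]] cell_basis_r_partition(2)[OF \<mu>]
    by simp
  then show ?thesis
    using alpha_adhm_data[OF \<mu>] unfolding A_fixed_big_def A_moduli_def alpha_def by auto
qed

lemma alphaQ_class_in_Q_fixed_T:
  assumes \<mu>: "\<mu> \<in> nested_partitions r n"
  shows "cyc_class r n (alphaQ_data r n \<mu>) \<in> Q_fixed_T r n"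
proof -
  have \<mu>': "\<mu> \<in> r_partitions r n" "nested r \<mu>" using \<mu> by (auto simp: nested_partitions_def)
  have "cyc_act r n t1 t2 t3 ` cyc_class r n (alphaQ_data r n \<mu>) = cyc_class r n (alphaQ_data r n \<mu>)"
    if "t1 \<noteq> 0" "t2 \<noteq> 0" "t3 \<noteq> 0" for t1 t2 t3
    using cyc_act_image_class[OF alphaQ_cyc_data[OF \<mu>] that]
      cell_basis.alphaQ_data_torus_fixed[OF cell_basis_r_partition(1)[OF \<mu>'(1)] \<mu>'(2)]
      cell_basis_r_partition(2)[OF \<mu>'(1)]
    by simp
  then show ?thesis
    using alphaQ_cyc_data[OF \<mu>] unfolding Q_fixed_T_def Q_moduli_def by auto
qed

lemma forget_B3_adhm_data:
  assumes "cyc_data r n x"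
  shows "adhm_data r n (forget_B3 x)"
proof -
  obtain B1 B2 B3 I J where x: "x = (B1, B2, B3, I, J)" by (cases x) auto
  have c: "B1 \<in> carrier_mat n n" "B2 \<in> carrier_mat n n" "B3 \<in> carrier_mat n n" "I \<in> carrier_mat n r"
    and comm: "B3 * B1 = B1 * B3" "B3 * B2 = B2 * B3" "B3 * I = I * shift_mat r"
    and st: "stable_wrt r n [B1, B2, B3] I"
    using assms by (auto simp: cyc_data_def x)
  have "stable_wrt r n (B3 # [B1, B2]) I" using stable_wrt_mono[OF st] by auto
  then have "stable_wrt r n [B1, B2] I"
    by (rule stable_wrt_drop_commuting[OF _ c(3) _ c(4) shift_mat_carrier comm(3)]) (use c comm in auto)
  then show ?thesis using assms by (simp add: adhm_data_def cyc_data_def forget_B3_def x)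
qed

lemma forget_B3_equiv: "cyc_equiv n x y \<Longrightarrow> adhm_equiv n (forget_B3 x) (forget_B3 y)"
  unfolding cyc_equiv_def adhm_equiv_def forget_B3_def by (auto split: prod.splits)

lemma iota_cyc_class:
  assumes x: "cyc_data r n x"
  shows "iota r n (cyc_class r n x) = adhm_class r n (forget_B3 x)"
proof -
  let ?y = "SOME y. y \<in> cyc_class r n x"
  have "?y \<in> cyc_class r n x" using cyc_mem_class[OF x] by (rule someI)
  then have y: "cyc_data r n ?y" "cyc_equiv n x ?y" by (auto simp: cyc_class_def)
  show ?thesis
    unfolding iota_def using adhm_class_eq[OF forget_B3_adhm_data[OF x] forget_B3_adhm_data[OF y(1)]
      forget_B3_equiv[OF y(2)]] by simp
qed

lemma iota_alphaQ_class:
  "\<mu> \<in> nested_partitions r n \<Longrightarrow> iota r n (cyc_class r n (alphaQ_data r n \<mu>)) = alpha r n \<mu>"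
  unfolding alpha_def using iota_cyc_class[OF alphaQ_cyc_data] forget_B3_alphaQ_data by simp

text \<open>\<open>\<mu>\<close> is recovered from any representative of \<open>\<alpha>\<^sub>\<mu>\<close> as the set of nonvanishing monomials.\<close>

lemma alpha_inj:
  assumes \<mu>: "\<mu> \<in> r_partitions r n" and \<nu>: "\<nu> \<in> r_partitions r n" and eq: "alpha r n \<mu> = alpha r n \<nu>"
  shows "\<mu> = \<nu>"
proof -
  interpret M: cell_basis r \<mu> using cell_basis_r_partition(1)[OF \<mu>] .
  interpret V: cell_basis r \<nu> using cell_basis_r_partition(1)[OF \<nu>] .
  have N: "M.N = n" "V.N = n" using cell_basis_r_partition(2) \<mu> \<nu> by auto
  have "alpha_data r n \<mu> \<in> alpha r n \<nu>" using adhm_mem_class[OF alpha_adhm_data[OF \<mu>]] eq by (simp add: alpha_def)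
  then have "adhm_equiv n (alpha_data r n \<nu>) (alpha_data r n \<mu>)" by (simp add: alpha_def adhm_class_def)
  then obtain g where g: "g \<in> carrier_mat n n" "invertible_mat g" "M.mu_B1 * g = g * V.mu_B1"
    "M.mu_B2 * g = g * V.mu_B2" "M.mu_I = g * V.mu_I"
    using M.alpha_data_eq V.alpha_data_eq N by (auto simp: adhm_equiv_def)
  have "M.mu_I = g * V.mu_I" by (rule g(5))
  then have "monomial_partition r M.mu_B1 M.mu_B2 M.mu_I = monomial_partition r V.mu_B1 V.mu_B2 V.mu_I"
    using monomial_partition_conj[OF g(1,2) V.mu_carrier(1,2)[unfolded N] M.mu_carrier(1,2)[unfolded N]
        V.mu_carrier(4)[unfolded N] g(3,4)] by simp
  then show ?thesis using M.monomial_partition_mu V.monomial_partition_mu by simp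
qed

section \<open>Classification of the torus-fixed data\<close>

lemma multiplicity_2_3_5:
  "multiplicity (2::nat) (2 ^ i * 3 ^ j * 5 ^ a) = i"
  "multiplicity (3::nat) (2 ^ i * 3 ^ j * 5 ^ a) = j"
  "multiplicity (5::nat) (2 ^ i * 3 ^ j * 5 ^ a) = a"
proof -
  have other: "prime (p::nat) \<Longrightarrow> prime q \<Longrightarrow> p \<noteq> q \<Longrightarrow> multiplicity p (q ^ k) = 0" for p q k
    by (rule not_dvd_imp_multiplicity_0) (metis prime_dvd_power primes_dvd_imp_eq)
  have p: "prime (2::nat)" "prime (3::nat)" "prime (5::nat)" by simp_all
  show "multiplicity (2::nat) (2 ^ i * 3 ^ j * 5 ^ a) = i"
    "multiplicity (3::nat) (2 ^ i * 3 ^ j * 5 ^ a) = j"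
    "multiplicity (5::nat) (2 ^ i * 3 ^ j * 5 ^ a) = a"
    using other p by (simp_all add: prime_elem_multiplicity_mult_distrib)
qed

lemma power_2_3_5_eq_iff:
  "(2 ^ i * 3 ^ j * 5 ^ a :: complex) = 2 ^ i' * 3 ^ j' * 5 ^ a' \<longleftrightarrow> (i, j, a) = (i', j', a')"
proof
  assume "(2 ^ i * 3 ^ j * 5 ^ a :: complex) = 2 ^ i' * 3 ^ j' * 5 ^ a'"
  then have "(of_nat (2 ^ i * 3 ^ j * 5 ^ a) :: complex) = of_nat (2 ^ i' * 3 ^ j' * 5 ^ a')" by simp
  then have "(2::nat) ^ i * 3 ^ j * 5 ^ a = 2 ^ i' * 3 ^ j' * 5 ^ a'" by (simp only: of_nat_eq_iff)
  then show "(i, j, a) = (i', j', a')" using multiplicity_2_3_5[of i j a] multiplicity_2_3_5[of i' j' a'] by metis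
qed simp

lemma six_times_power_2_3_5_neq: "(6::complex) * (2 ^ p * 3 ^ q * 5 ^ a) \<noteq> 5 ^ b"
proof -
  have "even (6 * (2 ^ p * 3 ^ q * 5 ^ a) :: nat)" "odd (5 ^ b :: nat)" by simp_all
  then have "(6 * (2 ^ p * 3 ^ q * 5 ^ a) :: nat) \<noteq> 5 ^ b" by metis
  then have "(of_nat (6 * (2 ^ p * 3 ^ q * 5 ^ a)) :: complex) \<noteq> of_nat (5 ^ b)"
    by (simp only: of_nat_eq_iff not_False_eq_True)
  then show ?thesis by simp
qed

definition apply_word :: "complex mat list \<Rightarrow> complex vec \<Rightarrow> complex vec" where
  "apply_word ws v = foldr (\<lambda>B w. B *\<^sub>v w) ws v"

text \<open>A single torus element \<open>(2, 3, 5)\<close> already detects all \<open>\<^bold>T\<close>-fixed points: the characters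
  \<open>2\<^sup>i 3\<^sup>j 5\<^sup>a\<close> of the monomials \<open>x\<^sup>i y\<^sup>j\<close> in summand \<open>a\<close> are pairwise distinct, and none of them
  equals a weight \<open>5\<^sup>b / 6\<close> of \<open>J\<close>. The locale records an ADHM datum fixed by this element,
  \<open>g\<close> being the compensating gauge transformation.\<close>

locale torus_fixed_adhm =
  fixes r n :: nat and B1 B2 I J g :: "complex mat"
  assumes data: "adhm_data r n (B1, B2, I, J)" and g: "g \<in> carrier_mat n n"
    and g_B1: "(2 \<cdot>\<^sub>m B1) * g = g * B1" and g_B2: "(3 \<cdot>\<^sub>m B2) * g = g * B2"
    and g_I: "I * diag_matrix r (\<lambda>a. 5 ^ a) = g * I"
    and g_J: "diag_matrix r (\<lambda>a. 6 * inverse (5 ^ a)) * J * g = J"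
begin

lemma carrier: "B1 \<in> carrier_mat n n" "B2 \<in> carrier_mat n n" "I \<in> carrier_mat n r" "J \<in> carrier_mat r n"
  using data by (auto simp: adhm_data_def)

lemma relation: "B1 * B2 + I * J = B2 * B1"
  using data adhm_relation_iff[OF carrier] by (simp add: adhm_data_def)

lemma stable: "stable_wrt r n [B1, B2] I"
  using data by (simp add: adhm_data_def)

lemma g_col_I:
  assumes a: "a < r"
  shows "g *\<^sub>v col I a = 5 ^ a \<cdot>\<^sub>v col I a"
proof -
  have "g *\<^sub>v col I a = col (I * diag_matrix r (\<lambda>a. 5 ^ a)) a"
    using g_I col_mult2[OF g carrier(3) a] by simp
  also have "\<dots> = I *\<^sub>v (5 ^ a \<cdot>\<^sub>v unit_vec r a)"
    using col_mult2[OF carrier(3) diag_matrix_carrier a, of "\<lambda>a. 5 ^ a"]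
      col_diag_matrix[OF a, of "\<lambda>a. (5::complex) ^ a"] by simp
  also have "\<dots> = 5 ^ a \<cdot>\<^sub>v col I a"
    using a by (simp add: mult_mat_vec[OF carrier(3)] mult_unit_vec_eq_col[OF carrier(3)])
  finally show ?thesis .
qed

lemma J_mult_g: "v \<in> carrier_vec n \<Longrightarrow> b < r \<Longrightarrow> 6 * (J *\<^sub>v (g *\<^sub>v v)) $ b = 5 ^ b * (J *\<^sub>v v) $ b"
proof -
  assume v: "v \<in> carrier_vec n" and b: "b < r"
  have "J *\<^sub>v v = diag_matrix r (\<lambda>a. 6 * inverse (5 ^ a)) *\<^sub>v (J *\<^sub>v (g *\<^sub>v v))"
    using arg_cong[OF g_J, of "\<lambda>M. M *\<^sub>v v"]
      assoc_mult_mat_vec[OF mult_carrier_mat[OF diag_matrix_carrier carrier(4)] g v]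
      assoc_mult_mat_vec[OF diag_matrix_carrier carrier(4) mult_mat_vec_carrier[OF g v]] by simp
  then have "(J *\<^sub>v v) $ b = 6 * inverse (5 ^ b) * (J *\<^sub>v (g *\<^sub>v v)) $ b"
    using diag_matrix_mult_vec_index[OF b, of "J *\<^sub>v (g *\<^sub>v v)"] g v carrier(4) by simp
  then show ?thesis by (simp add: field_simps)
qed

lemma eigen_step:
  assumes B: "B \<in> carrier_mat n n" and gB: "(t \<cdot>\<^sub>m B) * g = g * B"
    and v: "v \<in> carrier_vec n" and e: "g *\<^sub>v v = l \<cdot>\<^sub>v v"
  shows "g *\<^sub>v (B *\<^sub>v v) = (t * l) \<cdot>\<^sub>v (B *\<^sub>v v)"
proof -
  have "g *\<^sub>v (B *\<^sub>v v) = ((t \<cdot>\<^sub>m B) * g) *\<^sub>v v" using B v g by (simp add: gB)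
  also have "\<dots> = t \<cdot>\<^sub>v (B *\<^sub>v (l \<cdot>\<^sub>v v))"
    using assoc_mult_mat_vec[OF smult_carrier_mat[OF B] g v] B v g e by (simp add: smult_mat_mult_vec[of _ n n])
  also have "\<dots> = (t * l) \<cdot>\<^sub>v (B *\<^sub>v v)" using B v by (simp add: mult_mat_vec[of _ n n] smult_smult_assoc)
  finally show ?thesis .
qed

lemma apply_word_carrier: "set ws \<subseteq> {B1, B2} \<Longrightarrow> v \<in> carrier_vec n \<Longrightarrow> apply_word ws v \<in> carrier_vec n"
  by (induction ws) (use carrier in \<open>auto simp: apply_word_def\<close>)

lemma apply_word_eigen:
  assumes ws: "set ws \<subseteq> {B1, B2}" and v: "v \<in> carrier_vec n" and e: "g *\<^sub>v v = l \<cdot>\<^sub>v v"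
  shows "\<exists>p q. g *\<^sub>v apply_word ws v = ((2::complex) ^ p * 3 ^ q * l) \<cdot>\<^sub>v apply_word ws v"
  using ws
proof (induction ws)
  case Nil
  then show ?case using e by (auto simp: apply_word_def intro!: exI[of _ 0])
next
  case (Cons B ws)
  then obtain p q where pq: "g *\<^sub>v apply_word ws v = ((2::complex) ^ p * 3 ^ q * l) \<cdot>\<^sub>v apply_word ws v"
    by auto
  have w: "apply_word ws v \<in> carrier_vec n" using Cons apply_word_carrier v by auto
  have eq: "apply_word (B # ws) v = B *\<^sub>v apply_word ws v" by (simp add: apply_word_def)
  consider "B = B1" | "B = B2" using Cons by auto
  then show ?case
  proof cases
    case 1
    then have "g *\<^sub>v apply_word (B # ws) v = ((2::complex) ^ Suc p * 3 ^ q * l) \<cdot>\<^sub>v apply_word (B # ws) v"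
      using eigen_step[OF carrier(1) g_B1 w pq] eq by (simp add: mult.assoc)
    then show ?thesis by blast
  next
    case 2
    then have "g *\<^sub>v apply_word (B # ws) v = ((2::complex) ^ p * 3 ^ Suc q * l) \<cdot>\<^sub>v apply_word (B # ws) v"
      using eigen_step[OF carrier(2) g_B2 w pq] eq by (simp add: mult.assoc mult.left_commute)
    then show ?thesis by blast
  qed
qed

lemma J_apply_word_col_I:
  assumes a: "a < r" and ws: "set ws \<subseteq> {B1, B2}"
  shows "J *\<^sub>v apply_word ws (col I a) = 0\<^sub>v r"
proof -
  define u where "u = apply_word ws (col I a)"
  have u: "u \<in> carrier_vec n" unfolding u_def using apply_word_carrier[OF ws] carrier(3) by simp
  obtain p q where pq: "g *\<^sub>v u = ((2::complex) ^ p * 3 ^ q * 5 ^ a) \<cdot>\<^sub>v u"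
    using apply_word_eigen[OF ws _ g_col_I[OF a]] carrier(3) unfolding u_def by auto
  show ?thesis unfolding u_def[symmetric]
  proof (rule eq_vecI)
    fix b assume "b < dim_vec (0\<^sub>v r :: complex vec)"
    then have b: "b < r" by simp
    have "(J *\<^sub>v (g *\<^sub>v u)) $ b = ((2::complex) ^ p * 3 ^ q * 5 ^ a) * (J *\<^sub>v u) $ b"
      using pq carrier(4) u b by (simp add: mult_mat_vec[OF carrier(4)])
    then have "(6 * ((2::complex) ^ p * 3 ^ q * 5 ^ a) - 5 ^ b) * (J *\<^sub>v u) $ b = 0"
      using J_mult_g[OF u b] by (simp add: algebra_simps)
    then show "(J *\<^sub>v u) $ b = 0\<^sub>v r $ b" using six_times_power_2_3_5_neq[of p q a b] b by simp
  qed (use carrier(4) in simp)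
qed

lemma apply_word_zero: "set ws \<subseteq> {B1, B2} \<Longrightarrow> apply_word ws (0\<^sub>v n) = 0\<^sub>v n"
  by (induction ws) (use carrier in \<open>auto simp: apply_word_def\<close>)

lemma apply_word_add:
  "set ws \<subseteq> {B1, B2} \<Longrightarrow> v \<in> carrier_vec n \<Longrightarrow> w \<in> carrier_vec n \<Longrightarrow>
    apply_word ws (v + w) = apply_word ws v + apply_word ws w"
proof (induction ws)
  case (Cons B ws)
  then have B: "B \<in> carrier_mat n n" using carrier by auto
  show ?case using Cons apply_word_carrier[of ws] by (simp add: apply_word_def mult_add_distrib_mat_vec[OF B])
qed (simp add: apply_word_def)

lemma apply_word_smult:
  "set ws \<subseteq> {B1, B2} \<Longrightarrow> v \<in> carrier_vec n \<Longrightarrow> apply_word ws (c \<cdot>\<^sub>v v) = c \<cdot>\<^sub>v apply_word ws v"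
proof (induction ws)
  case (Cons B ws)
  then have B: "B \<in> carrier_mat n n" using carrier by auto
  show ?case using Cons apply_word_carrier[of ws] by (simp add: apply_word_def mult_mat_vec[OF B])
qed (simp add: apply_word_def)

text \<open>The largest \<open>B\<^sub>1, B\<^sub>2\<close>-invariant subspace inside \<open>ker J\<close> contains \<open>Im I\<close>, so by
  stability it is everything.\<close>

lemma J_eq_zero: "J = 0\<^sub>m r n"
proof -
  define S where "S = {v \<in> carrier_vec n. \<forall>ws. set ws \<subseteq> {B1, B2} \<longrightarrow> J *\<^sub>v apply_word ws v = 0\<^sub>v r}"
  have "S = carrier_vec n"
  proof (rule stable_wrtD[OF stable])
    show "vsubspace n S"
      unfolding vsubspace_def S_def
      using carrier(4) apply_word_carrier apply_word_add apply_word_smult apply_word_zero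
      by (auto simp: mult_add_distrib_mat_vec[OF carrier(4)] mult_mat_vec[OF carrier(4)])
    show "B *\<^sub>v v \<in> S" if "B \<in> set [B1, B2]" "v \<in> S" for B v
    proof -
      have "apply_word ws (B *\<^sub>v v) = apply_word (ws @ [B]) v" for ws by (simp add: apply_word_def)
      then show ?thesis using that carrier unfolding S_def by auto
    qed
    show "I *\<^sub>v w \<in> S" if "w \<in> carrier_vec r" for w
      by (rule mult_mat_vec_in_vsubspace[OF \<open>vsubspace n S\<close> carrier(3) _ that])
        (use carrier(3) J_apply_word_col_I in \<open>auto simp: S_def\<close>)
  qed
  then have "J *\<^sub>v v = 0\<^sub>v r" if "v \<in> carrier_vec n" for v
    using that unfolding S_def by (metis (mono_tags, lifting) apply_word_def empty_subsetI foldr_Nil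
        id_apply mem_Collect_eq set_empty)
  then show ?thesis by (intro mat_eqI_unit_vec[of _ r n]) (use carrier(4) in auto)
qed

lemma B1_B2_commute: "B1 * B2 = B2 * B1"
  using relation J_eq_zero carrier by (simp add: right_mult_zero_mat[of _ n r] mult_carrier_mat[of _ n n _ n])


abbreviation "mvec \<equiv> monomial r B1 B2 I"
abbreviation "part \<equiv> monomial_partition r B1 B2 I"

lemma mvec_carrier: "mvec c \<in> carrier_vec n"
  using monomial_carrier[OF carrier(1-3)] .

lemma mvec_x_shift: "B1 *\<^sub>v mvec c = mvec (x_shift c)"
proof -
  obtain a i j where c: "c = (a, i, j)" by (cases c) auto
  have "B1 *\<^sub>v (B1 ^\<^sub>m i *\<^sub>v w) = B1 ^\<^sub>m Suc i *\<^sub>v w" if "w \<in> carrier_vec n" for w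
    using assoc_mult_mat_vec[OF carrier(1) pow_carrier_mat[OF carrier(1)] that] pow_mat_Suc_left[OF carrier(1)]
    by simp
  then show ?thesis
    using carrier mult_mat_vec_carrier[OF pow_carrier_mat[OF carrier(2)] col_carrier_vec[OF carrier(3)]]
    by (auto simp: monomial_def x_shift_def c carrier_matD)
qed

lemma mvec_y_shift: "B2 *\<^sub>v mvec c = mvec (y_shift c)"
proof -
  obtain a i j where c: "c = (a, i, j)" by (cases c) auto
  have "B2 *\<^sub>v (B1 ^\<^sub>m i *\<^sub>v (B2 ^\<^sub>m j *\<^sub>v w)) = B1 ^\<^sub>m i *\<^sub>v (B2 ^\<^sub>m Suc j *\<^sub>v w)"
    if "w \<in> carrier_vec n" for w
  proof -
    have w': "B2 ^\<^sub>m j *\<^sub>v w \<in> carrier_vec n" by (rule mult_mat_vec_carrier[OF pow_carrier_mat[OF carrier(2)] that])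
    have "B2 *\<^sub>v (B2 ^\<^sub>m j *\<^sub>v w) = B2 ^\<^sub>m Suc j *\<^sub>v w"
      using assoc_mult_mat_vec[OF carrier(2) pow_carrier_mat[OF carrier(2)] that] pow_mat_Suc_left[OF carrier(2)]
      by simp
    then show ?thesis
      using pow_mat_mult_vec_intertwine[OF carrier(1) carrier(2) carrier(1) B1_B2_commute w'] by simp
  qed
  then show ?thesis
    using carrier by (auto simp: monomial_def y_shift_def c carrier_matD)
qed

lemma mvec_eigen:
  assumes a: "a < r"
  shows "g *\<^sub>v mvec (a, i, j) = (2 ^ i * 3 ^ j * 5 ^ a) \<cdot>\<^sub>v mvec (a, i, j)"
proof (induction i)
  case 0
  show ?case
  proof (induction j)
    case 0
    then show ?case using g_col_I[OF a] a carrier by (simp add: monomial_def carrier_matD)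
  next
    case (Suc j)
    have "g *\<^sub>v (B2 *\<^sub>v mvec (a, 0, j)) = (3 * (2 ^ 0 * 3 ^ j * 5 ^ a)) \<cdot>\<^sub>v (B2 *\<^sub>v mvec (a, 0, j))"
      by (rule eigen_step[OF carrier(2) g_B2 mvec_carrier Suc])
    then show ?case by (simp add: mvec_y_shift y_shift_def mult_ac)
  qed
next
  case (Suc i)
  have "g *\<^sub>v (B1 *\<^sub>v mvec (a, i, j)) = (2 * (2 ^ i * 3 ^ j * 5 ^ a)) \<cdot>\<^sub>v (B1 *\<^sub>v mvec (a, i, j))"
    by (rule eigen_step[OF carrier(1) g_B1 mvec_carrier Suc])
  then show ?case by (simp add: mvec_x_shift x_shift_def mult_ac)
qed

lemma mvec_zero_mono:
  assumes "mvec (a, i, j) = 0\<^sub>v n"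
  shows "mvec (a, i + d, j + e) = 0\<^sub>v n"
proof -
  have "mvec (a, i, j + e) = 0\<^sub>v n" for e
  proof (induction e)
    case (Suc e)
    then show ?case using mvec_y_shift[of "(a, i, j + e)"] carrier(2) by (simp add: y_shift_def)
  qed (use assms in simp)
  then show ?thesis
  proof (induction d)
    case (Suc d)
    then show ?case using mvec_x_shift[of "(a, i + d, j + e)"] carrier(1) by (simp add: x_shift_def)
  qed simp
qed

lemma mem_cells_part: "c \<in> cells r part \<longleftrightarrow> mvec c \<noteq> 0\<^sub>v n"
  using carrier(3) by (auto simp: cells_def monomial_partition_def monomial_def carrier_matD split: prod.splits)

text \<open>The nonzero monomials are eigenvectors of \<open>g\<close> with pairwise distinct eigenvalues, so there
  are at most \<open>n\<close> of them.\<close>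

lemma cells_part_finite_card: "finite (cells r part) \<and> card (cells r part) \<le> n"
proof -
  define ev where "ev = (\<lambda>(a, i, j). (2 ^ i * 3 ^ j * 5 ^ a :: complex))"
  let ?p = "char_poly g"
  have p: "degree ?p = n" "?p \<noteq> 0" using degree_monic_char_poly[OF g] by auto
  have "ev ` cells r part \<subseteq> {x. poly ?p x = 0}"
  proof
    fix x assume "x \<in> ev ` cells r part"
    then obtain a i j where c: "(a, i, j) \<in> cells r part" "x = ev (a, i, j)" by auto
    have "mvec (a, i, j) \<noteq> 0\<^sub>v n" "a < r" using c(1) mem_cells_part mem_cells by blast+
    then have "eigenvector g (mvec (a, i, j)) x"
      using c(2) mvec_eigen g mvec_carrier by (simp add: eigenvector_def ev_def)
    then show "x \<in> {x. poly ?p x = 0}" using eigenvalue_root_char_poly[OF g] by (auto simp: eigenvalue_def)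
  qed
  moreover have "inj ev" by (auto simp: ev_def inj_def power_2_3_5_eq_iff)
  moreover have "finite {x. poly ?p x = 0}" "card {x. poly ?p x = 0} \<le> n"
    using poly_roots_finite[OF p(2)] card_poly_roots_bound[OF p(2)] p(1) by auto
  ultimately show ?thesis
    by (metis card_image card_mono finite_imageD finite_subset inj_on_subset le_trans subset_UNIV)
qed

lemma young_family_part: "young_family r part"
  unfolding young_family_def
proof (intro conjI allI impI)
  fix a assume a: "a < r"
  have "part a \<subseteq> (\<lambda>(a, i, j). (i, j)) ` cells r part"
    using a by (force simp: cells_def)
  then have "finite (part a)" using cells_part_finite_card finite_subset by blast
  moreover have "(i', j') \<in> part a" if "(i, j) \<in> part a" "i' \<le> i" "j' \<le> j" for i j i' j'
    using that mvec_zero_mono[of a i' j' "i - i'" "j - j'"] by (auto simp: monomial_partition_def carrier_matD[OF carrier(3)])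
  ultimately show "young (part a)" unfolding young_def by blast
qed (simp add: monomial_partition_def)

end

sublocale torus_fixed_adhm \<subseteq> basis: cell_basis r "monomial_partition r B1 B2 I"
  by unfold_locales (rule young_family_part)

context torus_fixed_adhm
begin

definition basis_change :: "complex mat" where
  "basis_change = mat n basis.N (\<lambda>(i, k). mvec (basis.L ! k) $ i)"

lemma basis_change_carrier: "basis_change \<in> carrier_mat n basis.N"
  by (simp add: basis_change_def)

lemma basis_change_cell_vec: "basis_change *\<^sub>v basis.cell_vec c = mvec c"
proof (cases "c \<in> basis.C")
  case True
  then obtain l where l: "l < basis.N" "basis.L ! l = c" using basis.C_eq_L_nth by blast
  have "basis_change *\<^sub>v basis.cell_vec c = col basis_change l"
    using basis.cell_vec_L_nth[OF l(1)] l basis_change_carrier by (simp add: mult_unit_vec_eq_col)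
  also have "\<dots> = mvec c" using l mvec_carrier[of c] by (intro eq_vecI) (auto simp: basis_change_def)
  finally show ?thesis .
next
  case False
  then show ?thesis
    using basis_change_carrier mem_cells_part by (simp add: basis.cell_vec_eq_zero)
qed

lemma basis_change_intertwine:
  "B1 * basis_change = basis_change * basis.mu_B1"
  "B2 * basis_change = basis_change * basis.mu_B2"
  by (rule basis.mat_eqI_cell_vec[of _ n],
      use carrier basis_change_carrier in \<open>auto simp: mult_carrier_mat[of _ n n _ basis.N]
        mult_carrier_mat[of _ n basis.N _ basis.N] assoc_mult_mat_vec[of _ n n _ basis.N]
        assoc_mult_mat_vec[of _ n basis.N _ basis.N] basis_change_cell_vec mvec_x_shift mvec_y_shift
        basis.mu_B1_cell_vec basis.mu_B2_cell_vec\<close>)+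

lemma I_eq_basis_change: "I = basis_change * basis.mu_I"
proof (rule mat_eqI_unit_vec[of _ n r])
  fix a assume a: "a < r"
  have "I *\<^sub>v unit_vec r a = mvec (a, 0, 0)"
    using carrier a by (simp add: mult_unit_vec_eq_col monomial_def carrier_matD)
  also have "\<dots> = (basis_change * basis.mu_I) *\<^sub>v unit_vec r a"
    using a basis_change_carrier
    by (simp add: assoc_mult_mat_vec[of _ n basis.N _ r] basis.mu_I_unit_vec basis_change_cell_vec)
  finally show "I *\<^sub>v unit_vec r a = (basis_change * basis.mu_I) *\<^sub>v unit_vec r a" .
qed (use carrier basis_change_carrier in \<open>simp_all add: mult_carrier_mat[of _ n basis.N _ r]\<close>)

lemma basis_change_surj: "v \<in> carrier_vec n \<Longrightarrow> \<exists>w\<in>carrier_vec basis.N. basis_change *\<^sub>v w = v"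
proof -
  let ?S = "(\<lambda>w. basis_change *\<^sub>v w) ` carrier_vec basis.N"
  have mult_image: "B *\<^sub>v (basis_change *\<^sub>v w) \<in> ?S"
    if "B * basis_change = basis_change * B'" "B \<in> carrier_mat n n" "B' \<in> carrier_mat basis.N basis.N"
      "w \<in> carrier_vec basis.N" for B B' w
  proof -
    have "B *\<^sub>v (basis_change *\<^sub>v w) = basis_change *\<^sub>v (B' *\<^sub>v w)"
        using assoc_mult_mat_vec[OF that(2) basis_change_carrier that(4)]
        assoc_mult_mat_vec[OF basis_change_carrier that(3,4)] that(1) by simp
    then show ?thesis using that by simp
  qed
  have "?S = carrier_vec n"
  proof (rule stable_wrtD[OF stable vsubspace_image[OF basis_change_carrier]])
    show "B *\<^sub>v v \<in> ?S" if "B \<in> set [B1, B2]" "v \<in> ?S" for B v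
      using that mult_image basis_change_intertwine carrier basis.mu_carrier by auto
    show "I *\<^sub>v w \<in> ?S" if "w \<in> carrier_vec r" for w
    proof -
      have "I *\<^sub>v w = basis_change *\<^sub>v (basis.mu_I *\<^sub>v w)"
        using assoc_mult_mat_vec[OF basis_change_carrier basis.mu_carrier(4) that] I_eq_basis_change by simp
      then show ?thesis using mult_mat_vec_carrier[OF basis.mu_carrier(4) that] by (auto intro!: image_eqI)
    qed
  qed
  then show "v \<in> carrier_vec n \<Longrightarrow> \<exists>w\<in>carrier_vec basis.N. basis_change *\<^sub>v w = v"
    by (metis imageE)
qed

lemma card_cells_part: "basis.N = n"
  using surjective_mat_dim_eq[OF basis_change_carrier _ basis_change_surj] cells_part_finite_card by simp

lemma part_r_partition: "part \<in> r_partitions r n"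
  using r_partitions_iff young_family_part card_cells_part by simp

lemma invertible_basis_change: "basis_change \<in> carrier_mat n n" "invertible_mat basis_change"
proof -
  show P: "basis_change \<in> carrier_mat n n" using basis_change_carrier card_cells_part by simp
  show "invertible_mat basis_change"
    by (rule invertible_if_surjective[OF P]) (use basis_change_surj card_cells_part in auto)
qed

lemma equiv_alpha_part: "adhm_equiv n (alpha_data r n part) (B1, B2, I, J)"
proof -
  note P = invertible_basis_change
  have "J * basis_change = 0\<^sub>m r n"
    using J_eq_zero P by (simp add: left_mult_zero_mat[of _ n n])
  then show ?thesis
    using basis.alpha_data_eq card_cells_part basis_change_intertwine I_eq_basis_change P
    unfolding adhm_equiv_def by (auto intro!: bexI[of _ basis_change])
qed

end

locale torus_fixed_cyc = torus_fixed_adhm +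
  fixes B3 :: "complex mat"
  assumes B3_carrier: "B3 \<in> carrier_mat n n"
    and B3_B1: "B3 * B1 = B1 * B3" and B3_B2: "B3 * B2 = B2 * B3" and B3_I: "B3 * I = I * shift_mat r"
begin

lemma B3_col_I: "a < r \<Longrightarrow> B3 *\<^sub>v col I a = (if Suc a < r then col I (Suc a) else 0\<^sub>v n)"
proof -
  assume a: "a < r"
  have "B3 *\<^sub>v col I a = col (I * shift_mat r) a" using B3_carrier carrier(3) a B3_I by (simp flip: col_mult2)
  also have "\<dots> = I *\<^sub>v (shift_mat r *\<^sub>v unit_vec r a)"
    using col_mult2[OF carrier(3) shift_mat_carrier a] a by (simp add: mult_unit_vec_eq_col[of _ r r])
  also have "\<dots> = (if Suc a < r then col I (Suc a) else 0\<^sub>v n)"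
    using a carrier(3) by (simp add: shift_mat_unit_vec mult_unit_vec_eq_col[of _ n r])
  finally show ?thesis .
qed

lemma B3_mvec: "B3 *\<^sub>v mvec c = mvec (summand_shift c)"
proof -
  obtain a i j where c: "c = (a, i, j)" by (cases c) auto
  have "B3 *\<^sub>v (B1 ^\<^sub>m i *\<^sub>v (B2 ^\<^sub>m j *\<^sub>v w)) = B1 ^\<^sub>m i *\<^sub>v (B2 ^\<^sub>m j *\<^sub>v (B3 *\<^sub>v w))"
    if w: "w \<in> carrier_vec n" for w
    using pow_mat_mult_vec_intertwine[OF carrier(1) B3_carrier carrier(1) B3_B1[symmetric]]
      pow_mat_mult_vec_intertwine[OF carrier(2) B3_carrier carrier(2) B3_B2[symmetric] w]
      mult_mat_vec_carrier[OF pow_carrier_mat[OF carrier(2)] w] by simp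
  then show ?thesis
    using B3_col_I carrier B3_carrier
    by (auto simp: monomial_def summand_shift_def c carrier_matD
        mult_mat_zero_vec[OF pow_carrier_mat[OF carrier(1)]] mult_mat_zero_vec[OF pow_carrier_mat[OF carrier(2)]])
qed

lemma part_nested: "nested r part"
  unfolding nested_def
proof (intro allI impI subsetI)
  fix a x assume a: "Suc a < r" and x: "x \<in> part (Suc a)"
  obtain i j where x_eq: "x = (i, j)" by (cases x) auto
  have "mvec (Suc a, i, j) \<noteq> 0\<^sub>v n" using x carrier(3) by (simp add: monomial_partition_def x_eq carrier_matD)
  then have "mvec (a, i, j) \<noteq> 0\<^sub>v n" using B3_mvec[of "(a, i, j)"] B3_carrier by (auto simp: summand_shift_def)
  then show "x \<in> part a" using a carrier(3) by (simp add: monomial_partition_def x_eq carrier_matD)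
qed

lemma equiv_alphaQ_part: "cyc_equiv n (alphaQ_data r n part) (B1, B2, B3, I, J)"
proof -
  note P = invertible_basis_change
  have "B3 * basis_change = basis_change * basis.mu_B3"
    by (rule basis.mat_eqI_cell_vec[of _ n])
      (use B3_carrier basis_change_carrier in \<open>auto simp: mult_carrier_mat[of _ n n _ basis.N]
        mult_carrier_mat[of _ n basis.N _ basis.N] assoc_mult_mat_vec[of _ n n _ basis.N]
        assoc_mult_mat_vec[of _ n basis.N _ basis.N] basis_change_cell_vec B3_mvec
        basis.mu_B3_cell_vec[OF part_nested]\<close>)
  moreover have "J * basis_change = 0\<^sub>m r n"
    using J_eq_zero P by (simp add: left_mult_zero_mat[of _ n n])
  ultimately show ?thesis
    using basis.alphaQ_data_eq card_cells_part basis_change_intertwine I_eq_basis_change P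
    unfolding cyc_equiv_def by (auto intro!: bexI[of _ basis_change])
qed

end

section \<open>The fixed loci\<close>

lemma torus_fixed_adhm_if_fixed:
  assumes x: "adhm_data r n (B1, B2, I, J)"
    and fixed: "adhm_equiv n (B1, B2, I, J) (adhm_act r n (small_to_big 2 3 5) (B1, B2, I, J))"
  shows "\<exists>g. torus_fixed_adhm r n B1 B2 I J g"
proof -
  have "I \<in> carrier_mat n r" "J \<in> carrier_mat r n" using x by (auto simp: adhm_data_def)
  then obtain g where "g \<in> carrier_mat n n" "(2 \<cdot>\<^sub>m B1) * g = g * B1" "(3 \<cdot>\<^sub>m B2) * g = g * B2"
    "I * diag_matrix r (\<lambda>a. 5 ^ a) = g * I" "diag_matrix r (\<lambda>a. 6 * inverse (5 ^ a)) * J * g = J"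
    using fixed by (auto simp: small_to_big_def adhm_act_eq_mult adhm_equiv_def)
  then show ?thesis using x by (auto simp: torus_fixed_adhm_def)
qed

lemma torus_fixed_cyc_if_fixed:
  assumes x: "cyc_data r n (B1, B2, B3, I, J)"
    and fixed: "cyc_equiv n (B1, B2, B3, I, J) (cyc_act r n 2 3 5 (B1, B2, B3, I, J))"
  shows "\<exists>g. torus_fixed_cyc r n B1 B2 I J g B3"
proof -
  have "I \<in> carrier_mat n r" "J \<in> carrier_mat r n" using x by (auto simp: cyc_data_def)
  then obtain g where "g \<in> carrier_mat n n" "(2 \<cdot>\<^sub>m B1) * g = g * B1" "(3 \<cdot>\<^sub>m B2) * g = g * B2"
    "I * diag_matrix r (\<lambda>a. 5 ^ a) = g * I" "diag_matrix r (\<lambda>a. 6 * inverse (5 ^ a)) * J * g = J"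
    using fixed by (auto simp: cyc_act_eq_mult cyc_equiv_def)
  moreover have "adhm_data r n (B1, B2, I, J)" using forget_B3_adhm_data[OF x] by (simp add: forget_B3_def)
  ultimately show ?thesis
    using x by (auto simp: torus_fixed_cyc_def torus_fixed_cyc_axioms_def torus_fixed_adhm_def cyc_data_def)
qed

lemma A_fixed_T_eq_alpha:
  assumes X: "X \<in> A_fixed_T r n"
  shows "\<exists>\<mu>\<in>r_partitions r n. X = alpha r n \<mu>"
proof -
  obtain B1 B2 I J where x: "adhm_data r n (B1, B2, I, J)" and X_eq: "X = adhm_class r n (B1, B2, I, J)"
    using X unfolding A_fixed_T_def A_moduli_def by auto
  have "adhm_equiv n (B1, B2, I, J) (adhm_act r n (small_to_big 2 3 5) (B1, B2, I, J))"
    using adhm_equiv_act_of_fixed_class[OF x] X X_eq by (simp add: A_fixed_T_def)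
  then obtain g where "torus_fixed_adhm r n B1 B2 I J g" using torus_fixed_adhm_if_fixed[OF x] by blast
  then interpret F: torus_fixed_adhm r n B1 B2 I J g .
  show ?thesis
    using adhm_class_eq[OF alpha_adhm_data[OF F.part_r_partition] x F.equiv_alpha_part] F.part_r_partition
    unfolding X_eq alpha_def by blast
qed

lemma Q_fixed_T_eq_alphaQ:
  assumes X: "X \<in> Q_fixed_T r n"
  shows "\<exists>\<mu>\<in>nested_partitions r n. X = cyc_class r n (alphaQ_data r n \<mu>)"
proof -
  obtain B1 B2 B3 I J where x: "cyc_data r n (B1, B2, B3, I, J)" and X_eq: "X = cyc_class r n (B1, B2, B3, I, J)"
    using X unfolding Q_fixed_T_def Q_moduli_def by auto
  have "cyc_equiv n (B1, B2, B3, I, J) (cyc_act r n 2 3 5 (B1, B2, B3, I, J))"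
    using cyc_equiv_act_of_fixed_class[OF x _ cyc_mem_class[OF x]] X X_eq by (simp add: Q_fixed_T_def)
  then obtain g where "torus_fixed_cyc r n B1 B2 I J g B3" using torus_fixed_cyc_if_fixed[OF x] by blast
  then interpret F: torus_fixed_cyc r n B1 B2 I J g B3 .
  have \<mu>: "F.part \<in> nested_partitions r n"
    using F.part_r_partition F.part_nested by (simp add: nested_partitions_def)
  show ?thesis
    using cyc_class_eq[OF alphaQ_cyc_data[OF \<mu>] x F.equiv_alphaQ_part] \<mu> unfolding X_eq by blast
qed

lemma Q_fixed_T_J_eq_zero:
  assumes X: "X \<in> Q_fixed_T r n" and y: "y \<in> X"
  shows "case y of (B1, B2, B3, I, J) \<Rightarrow> J = 0\<^sub>m r n"
proof -
  obtain x where x: "cyc_data r n x" and X_eq: "X = cyc_class r n x"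
    using X unfolding Q_fixed_T_def Q_moduli_def by auto
  obtain B1 B2 B3 I J where y_eq: "y = (B1, B2, B3, I, J)" by (cases y) auto
  have "cyc_data r n y" "cyc_equiv n y (cyc_act r n 2 3 5 y)"
    using y cyc_equiv_act_of_fixed_class[OF x] X X_eq by (auto simp: Q_fixed_T_def cyc_class_def)
  then obtain g where "torus_fixed_cyc r n B1 B2 I J g B3" using torus_fixed_cyc_if_fixed y_eq by blast
  then show ?thesis using torus_fixed_adhm.J_eq_zero torus_fixed_cyc_def y_eq by fastforce
qed

lemma young_bound:
  assumes Y: "young Y" and ij: "(i, j) \<in> Y"
  shows "i < card Y" "j < card Y"
proof -
  have fin: "finite Y" using Y by (simp add: young_def)
  have "(\<lambda>k. (k, j)) ` {..i} \<subseteq> Y" "(\<lambda>k. (i, k)) ` {..j} \<subseteq> Y" using Y ij unfolding young_def by auto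
  then have "card ((\<lambda>k. (k, j)) ` {..i}) \<le> card Y" "card ((\<lambda>k. (i, k)) ` {..j}) \<le> card Y"
    using card_mono[OF fin] by blast+
  moreover have "card ((\<lambda>k. (k, j)) ` {..i}) = Suc i" "card ((\<lambda>k. (i, k)) ` {..j}) = Suc j"
    by (simp_all add: card_image inj_on_def)
  ultimately show "i < card Y" "j < card Y" by simp_all
qed

lemma finite_r_partitions: "finite (r_partitions r n)"
proof -
  have "r_partitions r n \<subseteq> {\<mu>. \<forall>a. (a \<in> {..<r} \<longrightarrow> \<mu> a \<in> Pow ({..<n} \<times> {..<n})) \<and> (a \<notin> {..<r} \<longrightarrow> \<mu> a = {})}"
  proof safe
    fix \<mu> a i j assume \<mu>: "\<mu> \<in> r_partitions r n" and ij: "(i, j) \<in> \<mu> a"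
    then have a: "a < r" "young (\<mu> a)" by (auto simp: r_partitions_def not_less[symmetric])
    have "card (\<mu> a) \<le> (\<Sum>b<r. card (\<mu> b))" using a by (intro member_le_sum) auto
    then have "card (\<mu> a) \<le> n" using \<mu> by (simp add: r_partitions_def)
    then show "i < n" "j < n" using young_bound[OF a(2) ij] by simp_all
  qed (auto simp: r_partitions_def)
  moreover have "finite {\<mu>. \<forall>a. (a \<in> {..<r} \<longrightarrow> \<mu> a \<in> Pow ({..<n} \<times> {..<n})) \<and> (a \<notin> {..<r} \<longrightarrow> \<mu> a = {})}"
    by (rule finite_set_of_finite_funs) simp_all
  ultimately show ?thesis by (rule finite_subset)
qed

lemma A_fixed_T_eq_A_fixed_big: "A_fixed_T r n = A_fixed_big r n"
proof
  show "A_fixed_T r n \<subseteq> A_fixed_big r n" using A_fixed_T_eq_alpha alpha_in_A_fixed_big by blast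
  have "small_to_big t1 t2 t3 \<in> big_torus r" if "t1 \<noteq> 0" "t2 \<noteq> 0" "t3 \<noteq> 0" for t1 t2 t3 :: complex
    using that by (simp add: small_to_big_def big_torus_def)
  then show "A_fixed_big r n \<subseteq> A_fixed_T r n" unfolding A_fixed_big_def A_fixed_T_def by blast
qed

lemma bij_betw_nested_partitions_Q_fixed_T:
  "bij_betw (\<lambda>\<mu>. cyc_class r n (alphaQ_data r n \<mu>)) (nested_partitions r n) (Q_fixed_T r n)"
proof (rule bij_betw_imageI)
  show "inj_on (\<lambda>\<mu>. cyc_class r n (alphaQ_data r n \<mu>)) (nested_partitions r n)"
  proof (rule inj_onI)
    fix \<mu> \<nu> assume \<mu>\<nu>: "\<mu> \<in> nested_partitions r n" "\<nu> \<in> nested_partitions r n"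
      and "cyc_class r n (alphaQ_data r n \<mu>) = cyc_class r n (alphaQ_data r n \<nu>)"
    then have "alpha r n \<mu> = alpha r n \<nu>" using iota_alphaQ_class by metis
    then show "\<mu> = \<nu>" using alpha_inj \<mu>\<nu> by (auto simp: nested_partitions_def)
  qed
  show "(\<lambda>\<mu>. cyc_class r n (alphaQ_data r n \<mu>)) ` nested_partitions r n = Q_fixed_T r n"
    using Q_fixed_T_eq_alphaQ alphaQ_class_in_Q_fixed_T by blast
qed

lemma alpha_in_iota_Q_fixed_T_iff:
  assumes \<mu>: "\<mu> \<in> r_partitions r n"
  shows "alpha r n \<mu> \<in> iota r n ` Q_fixed_T r n \<longleftrightarrow> nested r \<mu>"
proof
  assume "alpha r n \<mu> \<in> iota r n ` Q_fixed_T r n"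
  then obtain \<nu> where \<nu>: "\<nu> \<in> nested_partitions r n" "alpha r n \<mu> = alpha r n \<nu>"
    using Q_fixed_T_eq_alphaQ iota_alphaQ_class by force
  then show "nested r \<mu>" using alpha_inj[OF \<mu>] by (auto simp: nested_partitions_def)
next
  assume "nested r \<mu>"
  then have "\<mu> \<in> nested_partitions r n" using \<mu> by (simp add: nested_partitions_def)
  then show "alpha r n \<mu> \<in> iota r n ` Q_fixed_T r n"
    using iota_alphaQ_class alphaQ_class_in_Q_fixed_T by (metis image_eqI)
qed

lemma Q0_fixed_T_eq_Q_fixed_T: "Q0_fixed_T r n = Q_fixed_T r n"
  using Q_fixed_T_J_eq_zero unfolding Q0_fixed_T_def Q_fixed_T_def Q0_moduli_def by blast

theorem proposition4p1:
  fixes r n :: nat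
  shows "A_fixed_T r n = A_fixed_big r n
    \<and> (\<forall>\<mu> \<in> r_partitions r n. alpha r n \<mu> \<in> iota r n ` Q_fixed_T r n \<longleftrightarrow> nested r \<mu>)
    \<and> finite (Q_fixed_T r n)
    \<and> (\<exists>f. bij_betw f (nested_partitions r n) (Q_fixed_T r n)
           \<and> (\<forall>\<mu> \<in> nested_partitions r n. iota r n (f \<mu>) = alpha r n \<mu>))
    \<and> Q0_fixed_T r n = Q_fixed_T r n
    \<and> finite (Q0_fixed_T r n)
    \<and> (\<exists>f. bij_betw f (nested_partitions r n) (Q0_fixed_T r n))"
proof -
  have "finite (nested_partitions r n)"
    using finite_r_partitions by (rule finite_subset[rotated]) (auto simp: nested_partitions_def)
  then have "finite (Q_fixed_T r n)"
    using bij_betw_finite bij_betw_nested_partitions_Q_fixed_T by blast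
  then show ?thesis
    using A_fixed_T_eq_A_fixed_big alpha_in_iota_Q_fixed_T_iff bij_betw_nested_partitions_Q_fixed_T
      iota_alphaQ_class Q0_fixed_T_eq_Q_fixed_T
    by (auto intro!: exI[of _ "\<lambda>\<mu>. cyc_class r n (alphaQ_data r n \<mu>)"])
qed

end
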